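(* For every integer $n\ge 1$, the binomial polynomial $\binom{x}{n}=\frac{x(x-1)\cdots(x-n+1)}{n!}$ is absolutely irreducible in the ring $\operatorname{Int}(\mathbb{Z})=\{f\in\mathbb{Q}[x]\mid f(\mathbb{Z})\subseteq\mathbb{Z}\}$.
   Context: A non-zero non-unit $a$ of an integral domain $D$ is irreducible if $a=bc$ with $b,c\in D$ implies that $b$ or $c$ is a unit. An irreducible element $b\in D$ is absolutely irreducible if, for every integer $m\ge 1$, $b^m$ factors uniquely into irreducible elements of $D$ (uniqueness up to order and multiplication by units). *)

theory Defs
  imports
    "HOL-Algebra.Ring_Divisibility"
    "HOL-Computational_Algebra.Polynomial"
begin

text \<open>
  HOL-Algebra has two constants called \<open>mult_of\<close>; we use the one of
  \<open>Ring_Divisibility\<close>, i.e. the monoid of nonzero elements of a ring, as in the library's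
  locale \<open>factorial_domain\<close>.
\<close>

definition factors_uniquely :: "('a, 'b) ring_scheme \<Rightarrow> 'a \<Rightarrow> bool" where
  "factors_uniquely R a \<longleftrightarrow>
     (\<exists>fs. set fs \<subseteq> carrier (Ring_Divisibility.mult_of R) \<and>
           factors (Ring_Divisibility.mult_of R) fs a) \<and>
     (\<forall>fs gs. set fs \<subseteq> carrier (Ring_Divisibility.mult_of R) \<longrightarrow>
              set gs \<subseteq> carrier (Ring_Divisibility.mult_of R) \<longrightarrow>
              factors (Ring_Divisibility.mult_of R) fs a \<longrightarrow>
              factors (Ring_Divisibility.mult_of R) gs a \<longrightarrow>
              essentially_equal (Ring_Divisibility.mult_of R) fs gs)"

definition absolutely_irreducible :: "('a, 'b) ring_scheme \<Rightarrow> 'a \<Rightarrow> bool" where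
  "absolutely_irreducible R b \<longleftrightarrow>
     b \<in> carrier R \<and> ring_irreducible\<^bsub>R\<^esub> b \<and>
     (\<forall>m::nat. m \<ge> 1 \<longrightarrow> factors_uniquely R (b [^]\<^bsub>R\<^esub> m))"

text \<open>
  The library defines irreducibility by means of proper factors.  In a domain this is the usual
  condition on products.
\<close>

lemma (in domain) ring_irreducible_iff_product:
  assumes "a \<in> carrier R"
  shows "ring_irreducible\<^bsub>R\<^esub> a \<longleftrightarrow>
     a \<noteq> \<zero> \<and> a \<notin> Units R \<and>
     (\<forall>b\<in>carrier R. \<forall>c\<in>carrier R. a = b \<otimes> c \<longrightarrow> b \<in> Units R \<or> c \<in> Units R)"
  using assms ring_irreducibleE[OF assms] ring_irreducibleI[of a] by blast

definition Int_Z :: "rat poly ring" where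
  "Int_Z = \<lparr>carrier = {f. poly f ` \<int> \<subseteq> \<int>},
            mult = (*), one = 1, zero = 0, add = (+)\<rparr>"

lemma Int_Z_simps [simp]:
  "f \<in> carrier Int_Z \<longleftrightarrow> poly f ` \<int> \<subseteq> \<int>"
  "mult Int_Z = (*)" "one Int_Z = 1" "zero Int_Z = 0" "add Int_Z = (+)"
  by (simp_all add: Int_Z_def)

lemma Int_Z_domain: "domain Int_Z"
proof -
  have "\<exists>g. poly g ` \<int> \<subseteq> \<int> \<and> g + f = 0" if "poly f ` \<int> \<subseteq> \<int>" for f :: "rat poly"
    using that by (intro exI[of _ "-f"]) (auto simp: image_subset_iff)
  then have "abelian_group Int_Z"
    by (intro abelian_groupI) (auto simp: image_subset_iff add_ac Bex_def)
  moreover have "comm_monoid Int_Z"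
    by (intro comm_monoidI) (auto simp: image_subset_iff mult_ac)
  ultimately have "cring Int_Z"
    by (intro cringI) (auto simp: algebra_simps)
  then show ?thesis
    by (intro domain.intro) (auto simp: domain_axioms_def)
qed

definition binomial_poly :: "nat \<Rightarrow> rat poly" where
  "binomial_poly n = Polynomial.smult (1 / fact n) (\<Prod>i<n. [:- of_nat i, 1:])"

lemma poly_binomial_poly: "poly (binomial_poly n) x = x gchoose n"
  by (simp add: binomial_poly_def poly_prod gbinomial_prod_rev atLeast0LessThan)

end

theory Submission
  imports
    Defs
    "HOL-Computational_Algebra.Squarefree"
    "HOL-Number_Theory.Number_Theory"
    "HOL-Analysis.Harmonic_Numbers"
begin

text \<open>
  A factor of \<open>(x choose n) ^ m\<close> in \<open>Int(\<int>)\<close> has the form \<open>c \<cdot> \<Prod> (x - i) ^ a\<^sub>i\<close> with \<open>0 \<le> i < n\<close>.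
  Whenever a prime \<open>p\<close> does not divide \<open>x choose n\<close>, the value of the factor at \<open>x\<close> is a \<open>p\<close>-adic
  unit, so \<open>\<Sum> a\<^sub>i v\<^sub>p(x - i)\<close> does not depend on such an \<open>x\<close>. It suffices to show that these linear
  conditions force all \<open>a\<^sub>i\<close> to be equal. A prime \<open>P\<close> with \<open>n / 2 < P \<le> n\<close> makes the \<open>a\<^sub>i\<close> equal for
  \<open>n - P \<le> i < P\<close>. If they are equal for \<open>k \<le> i < n - k\<close>, then the range grows by one on each side as soon
  as there are a prime power \<open>q = p ^ j\<close> with \<open>\<phi>(q) \<ge> 2 k\<close> and some \<open>t < k\<close> such that \<open>q\<close> divides
  \<open>n - t\<close> and \<open>p\<close> does not divide \<open>k - 1 choose t\<close>: compare two values of \<open>x\<close> that differ by \<open>p ^ (j - 1)\<close>.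

  If there is no such \<open>q\<close>, then \<open>k (n choose k)\<close> is essentially bounded by the least common multiple of the
  prime powers of totient less than \<open>2 k\<close>, which is of size about \<open>exp (2 k)\<close>. Chebyshev's estimates contradict
  this for \<open>n \<ge> 5 k\<close>, and they also provide a prime \<open>P\<close> with \<open>n - P \<le> n / 5\<close> for large \<open>n\<close>; the small cases
  are checked numerically.
\<close>

section \<open>Balanced exponents\<close>

lemma multiplicity_less_of_less_power:
  fixes p d :: int
  assumes "prime p" "0 < d" "d < p ^ j"
  shows "multiplicity p d < j"
proof (rule ccontr)
  assume "\<not> multiplicity p d < j"
  then have "p ^ j dvd d"
    by (simp add: multiplicity_dvd')
  from zdvd_imp_le[OF this] assms show False by simp
qed

lemma multiplicity_add_multiple:
  fixes p d M :: int
  assumes p: "prime p" and d: "0 < d" "d < p ^ j" and M: "p ^ j dvd M"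
  shows "multiplicity p (M + d) = multiplicity p d"
    and "multiplicity p (M - d) = multiplicity p d"
proof -
  have *: "multiplicity p (M + d') = multiplicity p d'"
    if "multiplicity p d' < j" "d' \<noteq> 0" for d'
  proof (cases "M = 0")
    \<comment> \<open>Here \<open>M\<close> has valuation at least \<open>j\<close>. The case
      \<open>M = 0\<close> is separate because \<open>multiplicity p 0\<close> is 0, not
      infinite.\<close>
    case False
    have "\<not> is_unit p" using p by auto
    with False M have "multiplicity p M \<ge> j"
      by (intro multiplicity_geI) auto
    with False that show ?thesis
      using multiplicity_sum_lt[of p d' M] by (simp add: add.commute)
  qed auto
  have "multiplicity p d < j"
    by (rule multiplicity_less_of_less_power[OF p d])
  with *[of d] *[of "-d"] d show "multiplicity p (M + d) = multiplicity p d"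
    "multiplicity p (M - d) = multiplicity p d" by auto
qed

text \<open>If \<open>p ^ j\<close> does not divide \<open>d\<close>, the smaller valuation wins.
  Otherwise \<open>d\<close> and \<open>d + p ^ j\<close> are multiples of \<open>p ^ j\<close>
  below \<open>p ^ Suc j\<close>, so both have valuation \<open>j\<close>.\<close>

lemma multiplicity_add_power:
  fixes p d :: int
  assumes p: "prime p" and d: "0 < d" "d + p ^ j < p ^ Suc j"
  shows "multiplicity p (d + p ^ j) = multiplicity p d"
proof (cases "p ^ j dvd d")
  case True
  have pos: "p > 0" "p ^ j > 0" "\<not> is_unit p" using p by (auto simp: prime_gt_0_int)
  have "multiplicity p d < Suc j" "multiplicity p (d + p ^ j) < Suc j"
    using d pos by (intro multiplicity_less_of_less_power p; linarith)+
  moreover have "multiplicity p d \<ge> j" "multiplicity p (d + p ^ j) \<ge> j"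
    using d pos True by (intro multiplicity_geI; force)+
  ultimately show ?thesis by simp
next
  case False
  have "\<not> is_unit p" "p \<noteq> 0" using p by auto
  then have "multiplicity p d < j"
    using False d(1) by (meson multiplicity_dvd' not_le_imp_less)
  then show ?thesis
    using multiplicity_sum_lt[of p d "p ^ j"] p d \<open>\<not> is_unit p\<close> \<open>p \<noteq> 0\<close>
    by (simp add: multiplicity_same_power)
qed

text \<open>For prime \<open>p\<close> this says that \<open>p\<close> does not divide the integer
  \<open>x choose n\<close>. The first clause excludes zero values, whose
  \<open>multiplicity\<close> is 0 by default.\<close>

definition admissible :: "nat \<Rightarrow> int \<Rightarrow> int \<Rightarrow> bool" where
  "admissible n p x \<longleftrightarrow> (\<forall>i<n. x \<noteq> int i) \<and>
     multiplicity p (\<Prod>i<n. x - int i) = multiplicity p (fact n)"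

text \<open>The linear conditions on the exponents of a factor. The exponents are integers, not
  naturals, so that a constant can be subtracted.\<close>

definition balanced :: "nat \<Rightarrow> (nat \<Rightarrow> int) \<Rightarrow> bool" where
  "balanced n a \<longleftrightarrow> (\<forall>p. prime p \<longrightarrow> (\<exists>e. \<forall>x. admissible n p x \<longrightarrow>
     (\<Sum>i<n. a i * int (multiplicity p (x - int i))) = e))"

lemma balancedD:
  assumes "balanced n a" "prime p" "admissible n p x" "admissible n p y"
  shows "(\<Sum>i<n. a i * int (multiplicity p (x - int i))) =
         (\<Sum>i<n. a i * int (multiplicity p (y - int i)))"
  using assms unfolding balanced_def by metis

text \<open>The map \<open>x \<mapsto> n - 1 - x\<close> permutes the roots
  \<open>0, ..., n - 1\<close>, so the product changes only by the sign
  \<open>(- 1) ^ n\<close>.\<close>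

lemma admissible_reflect:
  assumes "admissible n p x"
  shows "admissible n p (int n - 1 - x)"
proof -
  have "(\<Prod>i<n. int n - 1 - x - int i) = (\<Prod>i<n. int n - 1 - x - int (n - Suc i))"
    by (rule prod.nat_diff_reindex[symmetric])
  also have "\<dots> = (\<Prod>i<n. - 1 * (x - int i))"
    by (intro prod.cong) auto
  also have "\<dots> = (- 1) ^ n * (\<Prod>i<n. x - int i)"
    by (subst prod.distrib) simp
  finally have "multiplicity p (\<Prod>i<n. int n - 1 - x - int i) = multiplicity p (\<Prod>i<n. x - int i)"
    by (cases "even n") auto
  moreover have "int n - 1 - x \<noteq> int i" if "i < n" for i
    using assms that unfolding admissible_def by (auto dest: spec[of _ "n - Suc i"])
  ultimately show ?thesis
    using assms by (simp add: admissible_def)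
qed

lemma balanced_reflect:
  assumes "balanced n a"
  shows "balanced n (\<lambda>i. a (n - Suc i))"
  unfolding balanced_def
proof (intro allI impI)
  fix p :: int assume p: "prime p"
  then obtain e where e: "\<And>x. admissible n p x \<Longrightarrow>
      (\<Sum>i<n. a i * int (multiplicity p (x - int i))) = e"
    using assms unfolding balanced_def by metis
  show "\<exists>e. \<forall>x. admissible n p x \<longrightarrow>
      (\<Sum>i<n. a (n - Suc i) * int (multiplicity p (x - int i))) = e"
  proof (intro exI[of _ e] allI impI)
    fix x assume x: "admissible n p x"
    have "(\<Sum>i<n. a (n - Suc i) * int (multiplicity p (x - int i))) =
       (\<Sum>i<n. a (n - Suc i) * int (multiplicity p (int n - 1 - x - int (n - Suc i))))"
    proof (intro sum.cong refl)
      fix i assume "i \<in> {..<n}"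
      then have "int n - 1 - x - int (n - Suc i) = - (x - int i)" by auto
      then show "a (n - Suc i) * int (multiplicity p (x - int i)) =
          a (n - Suc i) * int (multiplicity p (int n - 1 - x - int (n - Suc i)))"
        by (metis multiplicity_uminus_right)
    qed
    also have "\<dots> = (\<Sum>i<n. a i * int (multiplicity p (int n - 1 - x - int i)))"
      by (rule sum.nat_diff_reindex)
    also have "\<dots> = e"
      by (rule e[OF admissible_reflect[OF x]])
    finally show "(\<Sum>i<n. a (n - Suc i) * int (multiplicity p (x - int i))) = e" .
  qed
qed

text \<open>Constant exponents are balanced: for admissible \<open>x\<close> the valuations of the
  \<open>x - i\<close> add up to that of \<open>n!\<close>.\<close>

lemma balanced_minus_const:
  assumes "balanced n a"
  shows "balanced n (\<lambda>i. a i - c)"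
  unfolding balanced_def
proof (intro allI impI)
  fix p :: int assume p: "prime p"
  then obtain e where e: "\<And>x. admissible n p x \<Longrightarrow>
      (\<Sum>i<n. a i * int (multiplicity p (x - int i))) = e"
    using assms unfolding balanced_def by metis
  show "\<exists>e. \<forall>x. admissible n p x \<longrightarrow>
      (\<Sum>i<n. (a i - c) * int (multiplicity p (x - int i))) = e"
  proof (intro exI allI impI)
    fix x assume x: "admissible n p x"
    then have "(\<Sum>i<n. multiplicity p (x - int i)) = multiplicity p (fact n)"
      using p unfolding admissible_def
      by (subst prime_elem_multiplicity_prod_distrib[symmetric]) auto
    then have "c * int (multiplicity p (fact n)) = (\<Sum>i<n. c * int (multiplicity p (x - int i)))"
      by (simp flip: sum_distrib_left of_nat_sum)
    with e[OF x] show "(\<Sum>i<n. (a i - c) * int (multiplicity p (x - int i))) =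
        e - c * int (multiplicity p (fact n))"
      by (simp add: left_diff_distrib sum_subtractf)
  qed
qed

section \<open>Construction of admissible arguments\<close>

lemma prod_int_diff_eq_fact:
  "(\<Prod>i<m. int (m + d) - int i) * fact d = fact (m + d)"
proof (induction m)
  case (Suc m)
  have "(\<Prod>i<Suc m. int (Suc m + d) - int i) =
    int (Suc m + d) * (\<Prod>i<m. int (m + d) - int i)"
    by (subst prod.lessThan_Suc_shift) simp
  with Suc show ?case by (simp add: mult.assoc)
qed simp

text \<open>By Lucas, whether \<open>p\<close> divides \<open>M + s choose n\<close> depends only on the remainders \<open>s\<close> and \<open>t\<close>.\<close>

lemma admissible_add_multiple:
  assumes p: "prime p" and n: "int n = M + int t" and M: "p ^ j dvd M" and M0: "0 \<le> M"
    and s: "t \<le> s" "int s < p ^ j" and ndvd: "\<not> p dvd int (s choose t)"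
  shows "admissible n p (M + int s)"
proof -
  define d where "d = s - t"
  have x: "M + int s = int (n + d)" using n s by (simp add: d_def)
  \<comment> \<open>Both sides are \<open>(n + d)!\<close>. This trades the \<open>n\<close> factors
    in the numerator of \<open>x choose n\<close> for the \<open>d\<close> factors
    \<open>M + t + 1, ..., M + s\<close>.\<close>
  have "(\<Prod>i<n. M + int s - int i) * fact d = (\<Prod>i<d. int (d + n) - int i) * fact n"
    using prod_int_diff_eq_fact[of n d] prod_int_diff_eq_fact[of d n] unfolding x
    by (simp add: add.commute)
  moreover have "multiplicity p (\<Prod>i<d. int (d + n) - int i) = multiplicity p (fact d)"
  proof -
    have "multiplicity p (\<Prod>i<d. int (d + n) - int i) = (\<Sum>i<d. multiplicity p (int (d + n) - int i))"
      using p by (subst prime_elem_multiplicity_prod_distrib) auto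
    also have "\<dots> = (\<Sum>i<d. multiplicity p (int (d + t) - int i))"
    proof (intro sum.cong refl)
      fix i assume "i \<in> {..<d}"
      then have "multiplicity p (M + (int (d + t) - int i)) = multiplicity p (int (d + t) - int i)"
        using s by (intro multiplicity_add_multiple[OF p _ _ M]) (auto simp: d_def)
      then show "multiplicity p (int (d + n) - int i) = multiplicity p (int (d + t) - int i)"
        using n by (simp add: algebra_simps)
    qed
    also have "\<dots> = multiplicity p (\<Prod>i<d. int (d + t) - int i)"
      using p by (subst prime_elem_multiplicity_prod_distrib) auto
    \<comment> \<open>With \<open>M\<close> dropped the product is \<open>s! / t!\<close>, which
      differs from \<open>d!\<close> by the \<open>p\<close>-adic unit
      \<open>s choose t\<close>.\<close>
    also have "(\<Prod>i<d. int (d + t) - int i) = int (s choose t) * fact d"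
    proof -
      have "int (s choose t) * fact d * fact t = fact s"
        using arg_cong[OF binomial_fact_lemma[OF s(1)], of int]
        by (simp add: d_def mult.commute mult.left_commute)
      also have "\<dots> = (\<Prod>i<d. int (d + t) - int i) * fact t"
        using prod_int_diff_eq_fact[of d t] s by (simp add: d_def)
      finally show ?thesis by simp
    qed
    also have "multiplicity p \<dots> = multiplicity p (fact d)"
      using p ndvd s by (subst prime_elem_multiplicity_mult_distrib)
        (auto simp: not_dvd_imp_multiplicity_0)
    finally show ?thesis .
  qed
  moreover have nz: "(\<Prod>i<n. M + int s - int i) \<noteq> 0" "(\<Prod>i<d. int (d + n) - int i) \<noteq> 0"
    unfolding x by auto
  ultimately have "multiplicity p (\<Prod>i<n. M + int s - int i) = multiplicity p (fact n)"
    using prime_elem_multiplicity_mult_distrib[of p "\<Prod>i<n. M + int s - int i" "fact d"]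
      prime_elem_multiplicity_mult_distrib[of p "\<Prod>i<d. int (d + n) - int i" "fact n"]
      prime_imp_prime_elem[OF p]
    by simp
  then show ?thesis
    unfolding admissible_def using x by auto
qed

section \<open>Equality of exponents, from the middle outwards\<close>

lemma int_binomial_mult_fact:
  assumes "t \<le> s"
  shows "int (s choose t) * fact t = (\<Prod>i<t. int s - int i)"
proof -
  have "int (s choose t) * fact t * fact (s - t) = (\<Prod>i<t. int s - int i) * fact (s - t)"
    using arg_cong[OF binomial_fact_lemma[OF assms], of int] prod_int_diff_eq_fact[of t "s - t"] assms
    by (simp add: ac_simps)
  then show ?thesis by simp
qed

lemma multiplicity_binomial_add_fact:
  assumes "prime p" "t \<le> s"
  shows "multiplicity p (int (s choose t)) + multiplicity p (fact t :: int) =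
    (\<Sum>i<t. multiplicity p (int s - int i))"
proof -
  have "multiplicity p (int (s choose t)) + multiplicity p (fact t :: int) =
      multiplicity p (int (s choose t) * fact t)"
    using assms by (subst prime_elem_multiplicity_mult_distrib) auto
  also have "\<dots> = (\<Sum>i<t. multiplicity p (int s - int i))"
    unfolding int_binomial_mult_fact[OF assms(2)]
    using assms by (subst prime_elem_multiplicity_prod_distrib) auto
  finally show ?thesis .
qed

text \<open>The two arguments \<open>n - t + \<kappa>\<close> and \<open>n - t + \<kappa> + p ^ j\<close> give the same \<open>p\<close>-adic weights to all
  indices in the support of \<open>b\<close> except \<open>\<kappa>\<close>.\<close>

lemma balanced_left_end:
  assumes b: "balanced n b" and \<kappa>: "2 * Suc \<kappa> \<le> n"
    and zero: "\<And>i. \<kappa> < i \<Longrightarrow> Suc i + \<kappa> < n \<Longrightarrow> b i = 0"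
    and p: "prime p" and t: "t \<le> \<kappa>" and dvd: "p ^ Suc j dvd int n - int t"
    and ndvd: "\<not> p dvd int (\<kappa> choose t)" and large: "2 * (int \<kappa> + 1) \<le> p ^ Suc j - p ^ j"
  shows "b \<kappa> = 0"
proof -
  define M where "M = int n - int t"
  define q where "q = p ^ j"
  have p1: "p > 1" using p by (simp add: prime_gt_1_int)
  then have q0: "q > 0" by (simp add: q_def)
  have M0: "M > 0" using \<kappa> t by (simp add: M_def)
  have Q: "2 * (int \<kappa> + 1) + q \<le> p ^ Suc j" using large by (simp add: q_def)
  have same: "multiplicity p (d + q) = multiplicity p d" if "0 < d" "d + q < p ^ Suc j" for d
    using multiplicity_add_power[OF p] that unfolding q_def by blast
  have M: "p ^ Suc j dvd M" using dvd by (simp add: M_def)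
  have shift: "multiplicity p (M + d) = multiplicity p d" if "0 < d" "d < p ^ Suc j" for d
    by (rule multiplicity_add_multiple[OF p that M])
  define s where "s = \<kappa> + nat q"
  have s: "int s = int \<kappa> + q" using q0 by (simp add: s_def)
  \<comment> \<open>\<open>s choose t\<close> has the same valuation as
    \<open>\<kappa> choose t\<close>: the factors \<open>\<kappa> - i\<close> with
    \<open>i < t\<close> are positive, and adding \<open>q\<close> keeps their valuations.\<close>
  have "multiplicity p (int (s choose t)) + multiplicity p (fact t :: int) =
      (\<Sum>i<t. multiplicity p (int s - int i))"
    using t by (intro multiplicity_binomial_add_fact p) (simp add: s_def)
  also have "\<dots> = (\<Sum>i<t. multiplicity p (int \<kappa> - int i))"
  proof (intro sum.cong refl)
    fix i assume "i \<in> {..<t}"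
    then have "multiplicity p (int \<kappa> - int i + q) = multiplicity p (int \<kappa> - int i)"
      using t Q by (intro same) auto
    then show "multiplicity p (int s - int i) = multiplicity p (int \<kappa> - int i)"
      by (simp add: s algebra_simps)
  qed
  also have "\<dots> = multiplicity p (int (\<kappa> choose t)) + multiplicity p (fact t :: int)"
    using t by (intro multiplicity_binomial_add_fact[symmetric] p) simp
  also have "multiplicity p (int (\<kappa> choose t)) = 0"
    using ndvd by (rule not_dvd_imp_multiplicity_0)
  finally have "\<not> p dvd int (s choose t)"
    using p t by (simp add: s_def prime_multiplicity_gt_zero_iff flip: neq0_conv)
      (auto simp: multiplicity_eq_zero_iff)
  then have adm2: "admissible n p (M + int s)"
    using Q s t M M0 by (intro admissible_add_multiple[OF p, where t = t and j = "Suc j"])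
      (auto simp: M_def s_def)
  have adm1: "admissible n p (M + int \<kappa>)"
    using Q t M M0 ndvd q0 by (intro admissible_add_multiple[OF p, where t = t and j = "Suc j"])
      (auto simp: M_def)
  have "0 = (\<Sum>i<n. b i * int (multiplicity p (M + int s - int i))) -
      (\<Sum>i<n. b i * int (multiplicity p (M + int \<kappa> - int i)))"
    using balancedD[OF b p adm2 adm1] by simp
  also have "\<dots> = (\<Sum>i<n. b i * (int (multiplicity p (M + int s - int i)) -
      int (multiplicity p (M + int \<kappa> - int i))))"
    by (simp add: sum_subtractf right_diff_distrib)
  also have "\<dots> = (\<Sum>i\<in>{\<kappa>}. b i * (int (multiplicity p (M + int s - int i)) -
      int (multiplicity p (M + int \<kappa> - int i))))"
  proof (intro sum.mono_neutral_right ballI)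
    fix i assume i: "i \<in> {..<n} - {\<kappa>}"
    \<comment> \<open>The left end, the middle, where \<open>b\<close> vanishes, and the right end.
      At the right end \<open>M + \<kappa> - i\<close> lies between 1 and
      \<open>2 * \<kappa> + 1\<close>, so by \<open>large\<close> it stays below
      \<open>p ^ Suc j\<close> after adding \<open>q\<close>.\<close>
    consider "i < \<kappa>" | "\<kappa> < i" "Suc i + \<kappa> < n" | "\<kappa> < i" "n \<le> Suc i + \<kappa>"
      using i by fastforce
    then show "b i * (int (multiplicity p (M + int s - int i)) -
      int (multiplicity p (M + int \<kappa> - int i))) = 0"
    proof cases
      case 1
      have "multiplicity p (M + (int \<kappa> - int i)) = multiplicity p (int \<kappa> - int i)"
        using 1 Q q0 by (intro shift) auto
      moreover have "multiplicity p (M + (int \<kappa> - int i + q)) = multiplicity p (int \<kappa> - int i + q)"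
        using 1 Q q0 by (intro shift) auto
      moreover have "multiplicity p (int \<kappa> - int i + q) = multiplicity p (int \<kappa> - int i)"
        using 1 Q by (intro same) auto
      ultimately show ?thesis by (simp add: s algebra_simps)
    next
      case 3
      have "multiplicity p (M + int \<kappa> - int i + q) = multiplicity p (M + int \<kappa> - int i)"
        using 3 i t Q by (intro same) (auto simp: M_def)
      then show ?thesis by (simp add: s algebra_simps)
    qed (use zero in auto)
  qed (use \<kappa> in auto)
  also have "\<dots> = b \<kappa> * (int (multiplicity p (M + q)) - int (multiplicity p M))"
    by (simp add: s algebra_simps)
  \<comment> \<open>At \<open>i = \<kappa>\<close> the two values are \<open>M + q\<close>, of
    valuation exactly \<open>j\<close>, and \<open>M\<close>, of valuation at least
    \<open>Suc j\<close>.\<close>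
  also have "multiplicity p (M + q) = j"
    using shift[of q] Q q0 p p1 by (simp add: q_def multiplicity_same_power)
  finally have "b \<kappa> = 0 \<or> multiplicity p M = j" by auto
  moreover have "multiplicity p M \<ge> Suc j"
    using M M0 p by (intro multiplicity_geI) auto
  ultimately show ?thesis by simp
qed

text \<open>After subtracting \<open>c\<close> the middle vanishes and
  \<open>balanced_left_end\<close> applies with \<open>\<kappa> = k - 1\<close>; the reflected
  exponents give the right end. The condition \<open>large\<close> says that
  \<open>p ^ Suc j\<close> has totient at least \<open>2 * k\<close>.\<close>

lemma balanced_extend:
  assumes a: "balanced n a" and k: "0 < k" "2 * k \<le> n"
    and const: "\<And>i. k \<le> i \<Longrightarrow> i + k < n \<Longrightarrow> a i = c"
    and p: "prime p" and t: "t < k" and dvd: "p ^ Suc j dvd n - t"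
    and ndvd: "\<not> p dvd (k - 1 choose t)" and large: "2 * k + p ^ j \<le> p ^ Suc j"
  shows "\<forall>i. k - 1 \<le> i \<longrightarrow> i + (k - 1) < n \<longrightarrow> a i = c"
proof -
  have left: "b (k - 1) = c" if b: "balanced n b"
    and const: "\<And>i. k \<le> i \<Longrightarrow> i + k < n \<Longrightarrow> b i = c" for b
  proof -
    have "b (k - 1) - c = 0"
    proof (rule balanced_left_end[OF balanced_minus_const[OF b, of c], where p = "int p" and t = t and j = j])
      show "int p ^ Suc j dvd int n - int t"
        using dvd t k by (metis (no_types) diff_le_mono2 diff_is_0_eq int_dvd_int_iff le_trans
            less_imp_le_nat mult_2 of_nat_diff of_nat_power trans_le_add1)
      show "\<not> int p dvd int (k - 1 choose t)"
        using ndvd by simp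
      have "int (2 * k + p ^ j) \<le> int (p ^ Suc j)" using large by (rule of_nat_mono)
      then show "2 * (int (k - 1) + 1) \<le> int p ^ Suc j - int p ^ j"
        using k by simp
    qed (use p t k const in auto)
    then show ?thesis by simp
  qed
  have "a (k - 1) = c" by (rule left[OF a const])
  moreover have "a (n - Suc (k - 1)) = c"
    using k by (intro left[OF balanced_reflect[OF a]] const) auto
  ultimately show ?thesis
    using const k
  proof (intro allI impI)
    fix i assume i: "k - 1 \<le> i" "i + (k - 1) < n"
    then consider "i = k - 1" | "i = n - Suc (k - 1)" | "k \<le> i" "i + k < n"
      using k by linarith
    then show "a i = c" using \<open>a (k - 1) = c\<close> \<open>a (n - Suc (k - 1)) = c\<close> const by cases auto
  qed
qed

text \<open>At \<open>x = P + s\<close> the numbers \<open>x - i\<close> lie strictly between 0 and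
  \<open>2 * P\<close>, so only \<open>i = s\<close> gives a multiple of \<open>P\<close>, and the
  balanced sum is \<open>a s\<close>.\<close>

lemma balanced_const_middle:
  assumes a: "balanced n a" and P: "prime P" "P \<le> n" "n < 2 * P"
    and i: "n - P \<le> i" "i < P" and i': "n - P \<le> i'" "i' < P"
  shows "a i = a i'"
proof -
  have p: "prime (int P)" using P by simp
  have adm: "admissible n (int P) (int P + int s)" if s: "n - P \<le> s" "s < P" for s
  proof (rule admissible_add_multiple[OF p, where t = "n - P" and j = 1])
    have "(s choose (n - P)) dvd fact s"
      using s binomial_fact_lemma[of "n - P" s] by (metis dvd_triv_right)
    with P s have "\<not> P dvd (s choose (n - P))"
      using prime_dvd_fact_iff[OF P(1), of s] dvd_trans not_le by blast
    then show "\<not> int P dvd int (s choose (n - P))" by simp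
  qed (use s P in auto)
  have val: "(\<Sum>i<n. a i * int (multiplicity (int P) (int P + int s - int i))) = a s"
    if s: "n - P \<le> s" "s < P" for s
  proof -
    have "(\<Sum>i<n. a i * int (multiplicity (int P) (int P + int s - int i))) =
        (\<Sum>i\<in>{s}. a i * int (multiplicity (int P) (int P + int s - int i)))"
    proof (intro sum.mono_neutral_right ballI)
      fix i assume i: "i \<in> {..<n} - {s}"
      have "\<not> int P dvd int P + int s - int i"
      proof
        assume "int P dvd int P + int s - int i"
        then obtain m where m: "int P + int s - int i = int P * m" by auto
        have "int i < int n" "int n - int P \<le> int s" "int s < int P" "int n < 2 * int P" "int i \<noteq> int s"
          using s i P by auto
        then have "int P * m < int P * 2" "int P * 0 < int P * m" "int P * m \<noteq> int P * 1"
          unfolding m[symmetric] by linarith+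
        then show False by (auto simp: zero_less_mult_iff)
      qed
      then show "a i * int (multiplicity (int P) (int P + int s - int i)) = 0"
        by (simp add: not_dvd_imp_multiplicity_0)
    qed (use s P in auto)
    also have "\<dots> = a s" using p by (simp add: multiplicity_self)
    finally show ?thesis .
  qed
  show ?thesis
    using balancedD[OF a p adm[OF i] adm[OF i']] val[OF i] val[OF i'] by simp
qed

text \<open>Downward induction on \<open>k\<close> from \<open>n - P\<close> to 0; the constant
  range \<open>k \<le> i < n - k\<close> gains one index on each side per step.\<close>

lemma balanced_imp_const:
  assumes a: "balanced n a" and P: "prime P" "P \<le> n" "n < 2 * P"
    and ex: "\<And>k. 0 < k \<Longrightarrow> k \<le> n - P \<Longrightarrow> \<exists>p t j. prime p \<and> t < k \<and> p ^ Suc j dvd n - t \<and>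
       \<not> p dvd (k - 1 choose t) \<and> 2 * k + p ^ j \<le> p ^ Suc j"
  shows "\<exists>c. \<forall>i<n. a i = c"
proof -
  define c where "c = a (n - P)"
  have "\<forall>i. k \<le> i \<longrightarrow> i + k < n \<longrightarrow> a i = c" if "k \<le> n - P" for k
    using that
  proof (induction k rule: inc_induct)
    case base
    show ?case
      unfolding c_def using P by (intro allI impI balanced_const_middle[OF a P]) auto
  next
    case (step k)
    obtain p t j where "prime p" "t < Suc k" "p ^ Suc j dvd n - t"
      "\<not> p dvd (Suc k - 1 choose t)" "2 * Suc k + p ^ j \<le> p ^ Suc j"
      using ex[of "Suc k"] step.hyps by auto
    then show ?case
      using balanced_extend[OF a, of "Suc k" c p t j] step P by fastforce
  qed
  from this[of 0] show ?thesis by auto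
qed

section \<open>Divisors of powers of binomial polynomials\<close>

text \<open>Induction on the total multiplicity: a root of the product is a root of \<open>f\<close>
  or of \<open>g\<close>, and its linear factor is cancelled there.\<close>

lemma factor_of_split_poly:
  fixes f g :: "'a::field poly"
  assumes "finite A" "d \<noteq> 0" "f * g = Polynomial.smult d (\<Prod>i\<in>A. [:- r i, 1:] ^ m i)"
  shows "\<exists>c a. f = Polynomial.smult c (\<Prod>i\<in>A. [:- r i, 1:] ^ a i)"
  using assms(3)
proof (induction "sum m A" arbitrary: f g m)
  case 0
  then have "f * g = [:d:]" using assms(1) by simp
  then have "degree f = 0"
    using degree_mult_eq_0[of f g] assms(2) by auto
  then obtain c where "f = [:c:]" by (rule degree_eq_zeroE)
  then show ?case by (intro exI[of _ c] exI[of _ "\<lambda>_. 0"]) simp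
next
  case (Suc N)
  from Suc.hyps(2) obtain i where i: "i \<in> A" "m i > 0"
    by (metis gr0I old.nat.distinct(2) sum.neutral)
  define l where "l = [:- r i, 1:]"
  have l: "l \<noteq> 0" and root: "poly h (r i) = 0 \<longleftrightarrow> l dvd h" for h
    by (simp_all add: l_def poly_eq_0_iff_dvd)
  define m' where "m' = m(i := m i - 1)"
  have upd: "(\<Prod>j\<in>A. [:- r j, 1:] ^ (u(i := Suc v)) j) = l * (\<Prod>j\<in>A. [:- r j, 1:] ^ (u(i := v)) j)"
    for u v
  proof -
    have "(\<Prod>j\<in>A - {i}. [:- r j, 1:] ^ (u(i := Suc v)) j) = (\<Prod>j\<in>A - {i}. [:- r j, 1:] ^ (u(i := v)) j)"
      by (intro prod.cong) auto
    then show ?thesis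
      using assms(1) i by (simp add: prod.remove[of A i] l_def[symmetric] mult.assoc del: fun_upd_apply)
        (simp add: mult.assoc)
  qed
  have m: "m = m(i := Suc (m i - 1))" using i by auto
  have eq: "f * g = l * Polynomial.smult d (\<Prod>j\<in>A. [:- r j, 1:] ^ m' j)"
    unfolding Suc.prems m'_def by (subst m, subst upd) simp
  have "sum m A = m i + sum m (A - {i})" "sum m' A = m' i + sum m' (A - {i})"
    using assms(1) i by (simp_all add: sum.remove)
  moreover have "sum m' (A - {i}) = sum m (A - {i})"
    by (intro sum.cong) (auto simp: m'_def)
  ultimately have N: "N = sum m' A" using Suc.hyps(2) i by (simp add: m'_def)
  have "l dvd f * g" unfolding eq by (rule dvd_triv_left)
  then consider "l dvd f" | "l dvd g" by (auto simp flip: root)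
  then show ?case
  proof cases
    case 1
    then obtain f' where f': "f = l * f'" by auto
    have "f' * g = Polynomial.smult d (\<Prod>j\<in>A. [:- r j, 1:] ^ m' j)"
      using eq l unfolding f' mult.assoc by (metis mult_left_cancel)
    from Suc.hyps(1)[OF N this] obtain c a
      where "f' = Polynomial.smult c (\<Prod>j\<in>A. [:- r j, 1:] ^ a j)" by blast
    then have "f = Polynomial.smult c (\<Prod>j\<in>A. [:- r j, 1:] ^ (a(i := Suc (a i))) j)"
      unfolding f' upd by simp
    then show ?thesis by blast
  next
    case 2
    then obtain g' where g': "g = l * g'" by auto
    have "f * g' = Polynomial.smult d (\<Prod>j\<in>A. [:- r j, 1:] ^ m' j)"
      using eq l unfolding g' mult.left_commute[of f] by (metis mult_left_cancel)
    from Suc.hyps(1)[OF N this] show ?thesis .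
  qed
qed

section \<open>From factors in Int(\<int>) to balanced exponents\<close>

lemma binomial_poly_in_carrier: "binomial_poly n \<in> carrier Int_Z"
proof -
  have "(of_int x :: rat) gchoose n \<in> \<int>" for x :: int
    unfolding of_int_gbinomial[symmetric] by simp
  then show ?thesis by (auto simp: poly_binomial_poly elim!: Ints_cases)
qed

lemma degree_binomial_poly: "degree (binomial_poly n) = n"
  by (simp add: binomial_poly_def degree_prod_eq_sum_degree)

lemma binomial_poly_neq_0: "binomial_poly n \<noteq> 0"
  by (simp add: binomial_poly_def)

lemma Int_Z_value:
  assumes "f \<in> carrier Int_Z"
  obtains u :: int where "poly f (of_int x) = of_int u"
  using assms by (auto elim!: Ints_cases simp: image_subset_iff) (metis Ints_cases Ints_of_int)

lemma binomial_poly_value_not_dvd: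
  assumes "prime p" "admissible n p x" "poly (binomial_poly n) (of_int x) = of_int z"
  shows "\<not> p dvd z"
proof -
  have "(of_int z :: rat) * fact n = (\<Prod>i<n. of_int x - of_nat i)"
    unfolding assms(3)[symmetric] by (simp add: binomial_poly_def poly_prod)
  then have "(of_int (z * fact n) :: rat) = of_int (\<Prod>i<n. x - int i)" by simp
  then have eq: "z * fact n = (\<Prod>i<n. x - int i)" by (simp only: of_int_eq_iff)
  have "z \<noteq> 0"
    using eq assms(2) by (auto simp: admissible_def)
  then have "multiplicity p z + multiplicity p (fact n) = multiplicity p (fact n)"
    using assms(2) prime_elem_multiplicity_mult_distrib[OF prime_imp_prime_elem[OF assms(1)], of z "fact n"]
    unfolding eq by (simp add: admissible_def)
  with \<open>z \<noteq> 0\<close> assms(1) show ?thesis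
    by (auto simp: multiplicity_eq_zero_iff)
qed

text \<open>At an admissible \<open>x\<close> the integer \<open>f(x)\<close> divides a power of a
  \<open>p\<close>-adic unit, so its valuation is 0. Taking valuations in \<open>split\<close> then
  shows that every sum equals minus the valuation of \<open>c\<close>.\<close>

lemma balanced_exponents:
  assumes f: "f \<in> carrier Int_Z" and g: "g \<in> carrier Int_Z" and fg: "f * g = binomial_poly n ^ m"
    and split: "f = Polynomial.smult c (\<Prod>i<n. [:- of_nat i, 1:] ^ a i)"
  shows "balanced n (\<lambda>i. int (a i))"
  unfolding balanced_def
proof (intro allI impI)
  fix p :: int assume p: "prime p"
  obtain num den where c: "c = of_int num / of_int den" "den \<noteq> 0"
    by (metis quotient_of_denom_pos' quotient_of_div less_irrefl prod.collapse)
  have "f \<noteq> 0" using fg binomial_poly_neq_0 by auto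
  then have "num \<noteq> 0" using split c by auto
  show "\<exists>e. \<forall>x. admissible n p x \<longrightarrow> (\<Sum>i<n. int (a i) * int (multiplicity p (x - int i))) = e"
  proof (intro exI allI impI)
    fix x assume x: "admissible n p x"
    obtain u where u: "poly f (of_int x) = of_int u" using f by (rule Int_Z_value)
    obtain v where v: "poly g (of_int x) = of_int v" using g by (rule Int_Z_value)
    obtain z where z: "poly (binomial_poly n) (of_int x) = of_int z"
      using binomial_poly_in_carrier by (rule Int_Z_value)
    have "(of_int (u * v) :: rat) = of_int (z ^ m)"
      using arg_cong[OF fg, of "\<lambda>h. poly h (of_int x)"] by (simp add: u v z poly_power)
    then have uv: "u * v = z ^ m" by (simp only: of_int_eq_iff)
    have "\<not> p dvd z" by (rule binomial_poly_value_not_dvd[OF p x z])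
    then have "\<not> p dvd u * v"
      unfolding uv using prime_dvd_power[OF p] by blast
    then have ndvd: "\<not> p dvd u" and "u \<noteq> 0" by auto
    have "(of_int (u * den) :: rat) = of_int (num * (\<Prod>i<n. (x - int i) ^ a i))"
      using c u by (simp add: split poly_prod poly_power divide_eq_eq)
    then have eq: "u * den = num * (\<Prod>i<n. (x - int i) ^ a i)" by (simp only: of_int_eq_iff)
    have nz: "(\<Prod>i<n. (x - int i) ^ a i) \<noteq> 0" "\<And>i. i < n \<Longrightarrow> x - int i \<noteq> 0"
      using x by (auto simp: admissible_def)
    have "multiplicity p u + multiplicity p den =
        multiplicity p num + multiplicity p (\<Prod>i<n. (x - int i) ^ a i)"
      using eq p nz \<open>u \<noteq> 0\<close> c(2) \<open>num \<noteq> 0\<close>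
      by (metis prime_elem_multiplicity_mult_distrib prime_imp_prime_elem)
    moreover have "multiplicity p (\<Prod>i<n. (x - int i) ^ a i) = (\<Sum>i<n. multiplicity p ((x - int i) ^ a i))"
      using p nz(2) by (intro prime_elem_multiplicity_prod_distrib) (auto simp: prime_imp_prime_elem)
    moreover have "(\<Sum>i<n. multiplicity p ((x - int i) ^ a i)) = (\<Sum>i<n. a i * multiplicity p (x - int i))"
      using p nz(2) by (intro sum.cong refl prime_elem_multiplicity_power_distrib) (auto simp: prime_imp_prime_elem)
    moreover have "multiplicity p u = 0" using ndvd by (rule not_dvd_imp_multiplicity_0)
    ultimately have "int (\<Sum>i<n. a i * multiplicity p (x - int i)) =
        int (multiplicity p den) - int (multiplicity p num)" by simp
    then show "(\<Sum>i<n. int (a i) * int (multiplicity p (x - int i))) =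
        int (multiplicity p den) - int (multiplicity p num)" by simp
  qed
qed

text \<open>Equal exponents make \<open>f\<close> a rational multiple of a power of the binomial
  polynomial. At \<open>n\<close>, where that polynomial is 1, the values of \<open>f\<close> and
  \<open>g\<close> are integers with product 1, so the multiple is 1 or -1.\<close>

lemma divisor_of_binomial_poly_power:
  assumes const: "\<And>a. balanced n a \<Longrightarrow> \<exists>c. \<forall>i<n. a i = c"
    and f: "f \<in> carrier Int_Z" and g: "g \<in> carrier Int_Z" and fg: "f * g = binomial_poly n ^ m"
  shows "\<exists>r. f = binomial_poly n ^ r \<or> f = - (binomial_poly n ^ r)"
proof -
  have pow: "Polynomial.smult (1 / fact n ^ r) (\<Prod>i<n. [:- of_nat i, 1:] ^ r) = binomial_poly n ^ r"
    for r by (simp add: binomial_poly_def smult_power prod_power_distrib power_one_over)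
  have "f * g = Polynomial.smult (1 / fact n ^ m) (\<Prod>i<n. [:- of_nat i, 1:] ^ m)"
    unfolding fg pow ..
  from factor_of_split_poly[OF _ _ this] obtain c a
    where split: "f = Polynomial.smult c (\<Prod>i<n. [:- of_nat i, 1:] ^ a i)" by auto
  from const[OF balanced_exponents[OF f g fg split]] obtain C where C: "\<And>i. i < n \<Longrightarrow> int (a i) = C"
    by auto
  define r where "r = nat C"
  have "(\<Prod>i<n. [:- of_nat i, 1:] ^ a i) = (\<Prod>i<n. [:- of_nat i, 1 :: rat:] ^ r)"
    by (intro prod.cong refl) (auto simp: r_def dest!: C)
  then have f_eq: "f = Polynomial.smult (c * fact n ^ r) (binomial_poly n ^ r)"
    unfolding split pow[symmetric] by simp
  obtain u where u: "poly f (of_int (int n)) = of_int u" using f by (rule Int_Z_value)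
  obtain v where v: "poly g (of_int (int n)) = of_int v" using g by (rule Int_Z_value)
  have one: "poly (binomial_poly n) (of_nat n) = 1"
    by (simp add: poly_binomial_poly flip: binomial_gbinomial)
  have "(of_int (u * v) :: rat) = of_int 1"
    using arg_cong[OF fg, of "\<lambda>h. poly h (of_nat n)"] u v one by (simp add: poly_power)
  then have "u * v = 1" by (simp only: of_int_eq_iff)
  then have "u = 1 \<or> u = - 1" by (rule pos_zmult_eq_1_iff_lemma)
  moreover have "c * fact n ^ r = of_int u"
    using u one by (simp add: f_eq poly_power)
  ultimately show ?thesis using f_eq by auto
qed

section \<open>Units, irreducibility and unique factorization in Int(\<int>)\<close>

lemma Int_Z_pow: "f [^]\<^bsub>Int_Z\<^esub> (m::nat) = f ^ m"
proof -
  interpret domain Int_Z by (rule Int_Z_domain)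
  show ?thesis by (induction m) simp_all
qed

lemma Int_Z_uminus_closed: "f \<in> carrier Int_Z \<Longrightarrow> - f \<in> carrier Int_Z"
  by (auto simp: image_subset_iff)

lemma Int_Z_Units: "1 \<in> Units Int_Z" "- 1 \<in> Units Int_Z"
  by (auto simp: Units_def image_subset_iff intro!: bexI[of _ "- 1"])

lemma degree_Units_Int_Z: "f \<in> Units Int_Z \<Longrightarrow> degree f = 0"
proof -
  assume "f \<in> Units Int_Z"
  then obtain g where "f * g = 1" by (auto simp: Units_def)
  then show "degree f = 0"
    by (metis degree_1 degree_mult_eq_0 dvd_triv_left is_unit_iff_degree mult_zero_left zero_neq_one)
qed

text \<open>Both cofactors are powers of the binomial polynomial up to sign. By degrees the
  exponents add up to 1, so one cofactor is 1 or -1. The hypothesis \<open>const\<close> is the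
  combinatorial core, proved as \<open>balanced_const\<close>.\<close>

lemma irreducible_binomial_poly:
  assumes n: "n \<ge> 1" and const: "\<And>a. balanced n a \<Longrightarrow> \<exists>c. \<forall>i<n. a i = c"
  shows "ring_irreducible\<^bsub>Int_Z\<^esub> (binomial_poly n)"
proof -
  interpret domain Int_Z by (rule Int_Z_domain)
  have "f \<in> Units Int_Z \<or> g \<in> Units Int_Z"
    if f: "f \<in> carrier Int_Z" and g: "g \<in> carrier Int_Z" and fg: "binomial_poly n = f * g" for f g
  proof -
    from divisor_of_binomial_poly_power[OF const f g, of 1] fg
    obtain r where r: "f = binomial_poly n ^ r \<or> f = - (binomial_poly n ^ r)" by auto
    from divisor_of_binomial_poly_power[OF const g f, of 1] fg
    obtain s where s: "g = binomial_poly n ^ s \<or> g = - (binomial_poly n ^ s)"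
      by (auto simp: mult.commute)
    have "degree f = r * n" "degree g = s * n"
      using r s by (auto simp: degree_power_eq binomial_poly_neq_0 degree_binomial_poly)
    moreover have "f \<noteq> 0" "g \<noteq> 0" using fg binomial_poly_neq_0[of n] by auto
    ultimately have "n = (r + s) * n"
      using degree_binomial_poly[of n] unfolding fg by (simp add: degree_mult_eq distrib_right)
    then have "r + s = 1" using n by auto
    then have "r = 0 \<or> s = 0" by auto
    then show ?thesis using r s Int_Z_Units by auto
  qed
  moreover have "binomial_poly n \<notin> Units Int_Z"
    using degree_Units_Int_Z[of "binomial_poly n"] n by (auto simp: degree_binomial_poly)
  ultimately show ?thesis
    by (subst ring_irreducible_iff_product[OF binomial_poly_in_carrier])
      (auto simp: binomial_poly_neq_0 simp del: Int_Z_simps(1))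
qed

text \<open>\<open>f\<close> is a power up to sign, and not the zeroth, being no unit. Splitting off
  one copy of the binomial polynomial leaves a unit \<open>h\<close>, whose degree forces the
  exponent 1.\<close>

lemma irreducible_divisor_of_binomial_poly_power:
  assumes n: "n \<ge> 1" and const: "\<And>a. balanced n a \<Longrightarrow> \<exists>c. \<forall>i<n. a i = c"
    and f: "f \<in> carrier Int_Z" and g: "g \<in> carrier Int_Z" and fg: "f * g = binomial_poly n ^ m"
    and irr: "ring_irreducible\<^bsub>Int_Z\<^esub> f"
  shows "f = binomial_poly n \<or> f = - binomial_poly n"
proof -
  interpret domain Int_Z by (rule Int_Z_domain)
  obtain r where r: "f = binomial_poly n ^ r \<or> f = - (binomial_poly n ^ r)"
    using divisor_of_binomial_poly_power[OF const f g fg] by auto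
  have f': "f \<notin> Units Int_Z" "\<And>b c. b \<in> carrier Int_Z \<Longrightarrow> c \<in> carrier Int_Z \<Longrightarrow> f = b * c \<Longrightarrow>
      b \<in> Units Int_Z \<or> c \<in> Units Int_Z"
    using irr unfolding ring_irreducible_iff_product[OF f] by auto
  have "r \<noteq> 0"
  proof
    assume "r = 0"
    then show False using r f'(1) Int_Z_Units by auto
  qed
  then obtain s where s: "r = Suc s" by (cases r) auto
  define h where "h = (if f = binomial_poly n ^ r then binomial_poly n ^ s else - (binomial_poly n ^ s))"
  have "binomial_poly n ^ s \<in> carrier Int_Z"
    using binomial_poly_in_carrier nat_pow_closed Int_Z_pow by metis
  then have h: "h \<in> carrier Int_Z" "f = binomial_poly n * h" "degree h = s * n"
    using r Int_Z_uminus_closed[of "binomial_poly n ^ s"]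
    by (auto simp: h_def s degree_power_eq binomial_poly_neq_0 degree_binomial_poly simp del: Int_Z_simps(1))
  have "binomial_poly n \<in> Units Int_Z \<or> h \<in> Units Int_Z"
    by (rule f'(2)[OF binomial_poly_in_carrier h(1,2)])
  then have "s = 0"
    using degree_Units_Int_Z[of "binomial_poly n"] degree_Units_Int_Z[of h] h(3) n
    by (auto simp: degree_binomial_poly)
  then show ?thesis using r s by simp
qed

lemma foldr_mult_Int_Z:
  "foldr (\<otimes>\<^bsub>Ring_Divisibility.mult_of Int_Z\<^esub>) fs \<one>\<^bsub>Ring_Divisibility.mult_of Int_Z\<^esub> = prod_list fs"
  by (induction fs) simp_all

lemma factors_binomial_poly_power:
  assumes n: "n \<ge> 1" and const: "\<And>a. balanced n a \<Longrightarrow> \<exists>c. \<forall>i<n. a i = c"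
    and fs: "set fs \<subseteq> carrier (Ring_Divisibility.mult_of Int_Z)"
    and fact: "factors (Ring_Divisibility.mult_of Int_Z) fs (binomial_poly n ^ m)"
  shows "set fs \<subseteq> {binomial_poly n, - binomial_poly n}" "length fs = m"
proof -
  interpret domain Int_Z by (rule Int_Z_domain)
  have prod: "prod_list fs = binomial_poly n ^ m"
    using fact unfolding factors_def foldr_mult_Int_Z by blast
  have closed: "prod_list gs \<in> carrier Int_Z" if "set gs \<subseteq> carrier Int_Z" for gs
    using that
  proof (induction gs)
    case (Cons f gs)
    then show ?case using m_closed[of f "prod_list gs"] by simp
  qed (use one_closed in simp)
  show "set fs \<subseteq> {binomial_poly n, - binomial_poly n}"
  proof
    fix f assume f: "f \<in> set fs"
    then obtain as bs where split: "fs = as @ f # bs" by (auto simp: in_set_conv_decomp)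
    have "prod_list (as @ bs) \<in> carrier Int_Z"
      using fs split by (intro closed) (auto simp del: Int_Z_simps(1))
    moreover have "f * prod_list (as @ bs) = binomial_poly n ^ m"
      unfolding prod[symmetric] split by (simp add: ac_simps)
    moreover have "ring_irreducible\<^bsub>Int_Z\<^esub> f"
      using fs f fact unfolding factors_def
      by (intro ring_irreducibleI') (auto simp del: Int_Z_simps(1))
    moreover have "f \<in> carrier Int_Z" using fs f by (auto simp del: Int_Z_simps(1))
    ultimately show "f \<in> {binomial_poly n, - binomial_poly n}"
      using irreducible_divisor_of_binomial_poly_power[OF n const] by blast
  qed
  then have "degree (prod_list fs) = length fs * n \<and> prod_list fs \<noteq> 0"
    by (induction fs) (auto simp: degree_mult_eq degree_binomial_poly binomial_poly_neq_0)
  then have "length fs * n = m * n"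
    by (auto simp: prod degree_power_eq binomial_poly_neq_0 degree_binomial_poly)
  then show "length fs = m" using n by simp
qed

lemma absolutely_irreducible_binomial_poly:
  assumes n: "n \<ge> 1" and const: "\<And>a. balanced n a \<Longrightarrow> \<exists>c. \<forall>i<n. a i = c"
  shows "absolutely_irreducible Int_Z (binomial_poly n)"
proof -
  interpret domain Int_Z by (rule Int_Z_domain)
  let ?C = "binomial_poly n" and ?M = "Ring_Divisibility.mult_of Int_Z"
  have irr: "ring_irreducible\<^bsub>Int_Z\<^esub> ?C"
    by (rule irreducible_binomial_poly[OF n const])
  have "factors_uniquely Int_Z (?C ^ m)" for m
    unfolding factors_uniquely_def
  proof (intro conjI allI impI)
    have "Divisibility.irreducible ?M ?C"
      using ring_irreducibleE(3)[OF binomial_poly_in_carrier irr] .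
    then show "\<exists>fs. set fs \<subseteq> carrier ?M \<and> factors ?M fs (?C ^ m)"
      using binomial_poly_in_carrier[of n] binomial_poly_neq_0[of n] unfolding factors_def foldr_mult_Int_Z
      by (intro exI[of _ "replicate m ?C"]) (auto simp del: Int_Z_simps(1))
  next
    fix fs gs
    assume *: "set fs \<subseteq> carrier ?M" "set gs \<subseteq> carrier ?M" "factors ?M fs (?C ^ m)" "factors ?M gs (?C ^ m)"
    have fs: "set fs \<subseteq> {?C, - ?C}" "length fs = m"
      by (rule factors_binomial_poly_power[OF n const *(1,3)], assumption)+
    have gs: "set gs \<subseteq> {?C, - ?C}" "length gs = m"
      by (rule factors_binomial_poly_power[OF n const *(2,4)], assumption)+
    have unit: "1 \<in> carrier ?M" "- 1 \<in> carrier ?M"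
      by (auto simp: image_subset_iff)
    have "x \<sim>\<^bsub>?M\<^esub> y" if "x \<in> {?C, - ?C}" "y \<in> {?C, - ?C}" for x y
    proof -
      from that consider "y = x * 1" "x = y * 1" | "y = x * - 1" "x = y * - 1" by auto
      then show ?thesis
        using unit unfolding associated_def factor_def mult_mult_of Int_Z_simps(2) by cases blast+
    qed
    \<comment> \<open>Any two factors are associated, so lists of equal length match entry by entry
      in the given order.\<close>
    then have "list_all2 (\<sim>\<^bsub>?M\<^esub>) fs gs"
      using fs gs by (auto simp: list_all2_conv_all_nth subset_iff)
    then show "essentially_equal ?M fs gs"
      unfolding essentially_equal_def by blast
  qed
  then show ?thesis
    unfolding absolutely_irreducible_def Int_Z_pow using irr binomial_poly_in_carrier by blast
qed

section \<open>Prime powers dividing consecutive integers\<close>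

lemma prod_diff_eq_fact_mult_fact:
  assumes "t0 < (k::nat)"
  shows "(\<Prod>t\<in>{..<k} - {t0}. if t < t0 then t0 - t else t - t0) = fact t0 * fact (k - 1 - t0)"
proof -
  have "{..<k} - {t0} = {..<t0} \<union> {t0<..<k}" using assms by auto
  then have "(\<Prod>t\<in>{..<k} - {t0}. if t < t0 then t0 - t else t - t0) =
      (\<Prod>t\<in>{..<t0} \<union> {t0<..<k}. if t < t0 then t0 - t else t - t0)" by simp
  also have "\<dots> = (\<Prod>t<t0. if t < t0 then t0 - t else t - t0) *
      (\<Prod>t\<in>{t0<..<k}. if t < t0 then t0 - t else t - t0)"
    by (intro prod.union_disjoint) auto
  also have "(\<Prod>t<t0. if t < t0 then t0 - t else t - t0) = (\<Prod>t<t0. t0 - t)"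
    by (intro prod.cong) auto
  also have "(\<Prod>t\<in>{t0<..<k}. if t < t0 then t0 - t else t - t0) = (\<Prod>t\<in>{t0<..<k}. t - t0)"
    by (intro prod.cong) auto
  also have "(\<Prod>t<t0. t0 - t) = (\<Prod>t<t0. Suc t)"
    by (subst prod.nat_diff_reindex[symmetric]) (auto intro!: prod.cong)
  also have "\<dots> = fact t0" by (simp add: fact_prod_Suc atLeast0LessThan)
  also have "(\<Prod>t\<in>{t0<..<k}. t - t0) = (\<Prod>t<k - 1 - t0. Suc t)"
    by (rule prod.reindex_bij_witness[of _ "\<lambda>t. Suc (t + t0)" "\<lambda>t. t - Suc t0"]) auto
  also have "\<dots> = fact (k - 1 - t0)" by (simp add: fact_prod_Suc atLeast0LessThan)
  finally show ?thesis .
qed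

text \<open>Splitting off \<open>(k - 1)!\<close> instead of \<open>k!\<close> suits the products of
  differences in \<open>prime_power_dvd_mult_binomial\<close>; hence all estimates concern
  \<open>k * (n choose k)\<close>.\<close>

lemma prod_falling_eq:
  assumes "0 < k" "k \<le> (n::nat)"
  shows "(\<Prod>t<k. n - t) = k * (n choose k) * fact (k - 1)"
proof -
  have "(\<Prod>t<k. n - t) * fact (n - k) = fact n"
    using assms(2)
  proof (induction k)
    case (Suc k)
    then have "fact (n - k) = (n - k) * fact (n - Suc k)"
      by (metis Suc_diff_Suc Suc_le_lessD fact_Suc of_nat_id)
    with Suc show ?case by (simp add: mult.assoc)
  qed simp
  also have "fact n = fact k * fact (n - k) * (n choose k)"
    by (rule binomial_fact_lemma[OF assms(2), symmetric])
  also have "fact k = k * fact (k - 1)" using fact_reduce[of k, where ?'a = nat] assms(1) by simp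
  also have "k * fact (k - 1) * fact (n - k) * (n choose k) = k * (n choose k) * fact (k - 1) * fact (n - k)"
    by (simp only: ac_simps)
  finally show ?thesis by simp
qed

text \<open>The term \<open>n - t\<close> of maximal \<open>p\<close>-adic valuation dominates: the valuations of the other terms
  are at most those of \<open>\<bar>t - t'\<bar>\<close>, which together make up \<open>(k - 1)! / (k - 1 choose t)\<close>.\<close>

lemma prime_power_dvd_mult_binomial:
  fixes p n k j :: nat
  assumes p: "prime p" and k: "0 < k" "k \<le> n" and dvd: "p ^ j dvd k * (n choose k)"
  shows "\<exists>t<k. p ^ j dvd n - t \<and> (\<not> p dvd (k - 1 choose t) \<or> p ^ Suc j dvd n - t)"
proof -
  define v where "v = multiplicity p"
  have pe: "prime_elem p" using p by auto
  have "Max ((\<lambda>t. v (n - t)) ` {..<k}) \<in> (\<lambda>t. v (n - t)) ` {..<k}"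
    using k(1) by (intro Max_in) auto
  then obtain t0 where "t0 < k" "v (n - t0) = Max ((\<lambda>t. v (n - t)) ` {..<k})" by auto
  then have "t0 < k \<and> (\<forall>t<k. v (n - t) \<le> v (n - t0))" by simp
  then obtain t0 where t0: "t0 < k" and max: "\<And>t. t < k \<Longrightarrow> v (n - t) \<le> v (n - t0)" by auto
  define b where "b = (k - 1 choose t0)"
  have b: "fact t0 * fact (k - 1 - t0) * b = fact (k - 1)"
    using t0 binomial_fact_lemma[of t0 "k - 1"] by (simp add: b_def)
  have nz: "b \<noteq> 0" "k * (n choose k) \<noteq> 0" "n - t0 \<noteq> 0" using t0 k by (auto simp: b_def)
  let ?R = "\<Prod>t\<in>{..<k} - {t0}. n - t" and ?D = "\<Prod>t\<in>{..<k} - {t0}. if t < t0 then t0 - t else t - t0"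
  have R: "?R \<noteq> 0" using k by auto
  have "v ?R = (\<Sum>t\<in>{..<k} - {t0}. v (n - t))"
    unfolding v_def using pe k by (intro prime_elem_multiplicity_prod_distrib) auto
  also have "\<dots> \<le> (\<Sum>t\<in>{..<k} - {t0}. v (if t < t0 then t0 - t else t - t0))"
  proof (intro sum_mono)
    fix t assume t: "t \<in> {..<k} - {t0}"
    \<comment> \<open>By maximality this power divides both numbers, hence their distance.\<close>
    have "p ^ v (n - t) dvd n - t" "p ^ v (n - t) dvd n - t0"
      using max[of t] t unfolding v_def by (auto intro: multiplicity_dvd multiplicity_dvd')
    then have "p ^ v (n - t) dvd (n - t) - (n - t0)" "p ^ v (n - t) dvd (n - t0) - (n - t)"
      by (simp_all only: dvd_diff_nat)
    then have "p ^ v (n - t) dvd (if t < t0 then t0 - t else t - t0)"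
      using t t0 k by auto
    then show "v (n - t) \<le> v (if t < t0 then t0 - t else t - t0)"
      unfolding v_def using t p by (intro multiplicity_geI) auto
  qed
  also have "\<dots> = v ?D"
    unfolding v_def using pe by (intro prime_elem_multiplicity_prod_distrib[symmetric]) (auto split: if_splits)
  finally have le: "v ?R \<le> v ?D" .
  have D: "?D = fact t0 * fact (k - 1 - t0)" by (rule prod_diff_eq_fact_mult_fact[OF t0])
  \<comment> \<open>The falling product is \<open>k * (n choose k) * (k - 1)!\<close>, and
    \<open>(k - 1)! = b * ?D\<close>. As the valuation of \<open>?R\<close> is at most that of
    \<open>?D\<close>, the one of \<open>n - t0\<close> dominates the rest.\<close>
  have "(n - t0) * ?R = k * (n choose k) * b * ?D"
    using prod_falling_eq[OF k] t0 b unfolding D by (subst (asm) prod.remove[of _ t0]) (auto simp: ac_simps)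
  then have "v (n - t0) + v ?R = v (k * (n choose k)) + v b + v ?D"
    unfolding v_def using nz R pe D
    by (metis (no_types, lifting) fact_nonzero mult_eq_0_iff prime_elem_multiplicity_mult_distrib)
  with le have main: "v (k * (n choose k)) + v b \<le> v (n - t0)" by simp
  have j: "j \<le> v (k * (n choose k))" unfolding v_def using dvd nz p by (intro multiplicity_geI) auto
  have "p ^ j dvd n - t0"
    using main j unfolding v_def by (intro multiplicity_dvd') simp
  moreover have "p ^ Suc j dvd n - t0" if "p dvd b"
  proof -
    have "v b > 0" unfolding v_def using that nz p by (simp add: prime_multiplicity_gt_zero_iff)
    with main j show ?thesis unfolding v_def by (intro multiplicity_dvd') simp
  qed
  ultimately show ?thesis using t0 unfolding b_def by blast
qed

text \<open>The failure of \<open>balanced_extend\<close> at \<open>k\<close>: every prime power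
  \<open>p ^ Suc j\<close> available there has totient \<open>p ^ Suc j - p ^ j\<close> below
  \<open>2 * k\<close>.\<close>

definition no_large_power :: "nat \<Rightarrow> nat \<Rightarrow> bool" where
  "no_large_power n k \<longleftrightarrow> (\<forall>p t j. prime p \<longrightarrow> t < k \<longrightarrow> p ^ Suc j dvd n - t \<longrightarrow>
     \<not> p dvd (k - 1 choose t) \<longrightarrow> p ^ Suc j < 2 * k + p ^ j)"

text \<open>For prime powers, \<open>d < 4 * k\<close> follows from \<open>totient d < 2 * k\<close>; it only makes the sum finite.\<close>

definition totient_psi :: "nat \<Rightarrow> real" where
  "totient_psi k = (\<Sum>d | d < 4 * k \<and> totient d < 2 * k. mangoldt d)"

section \<open>Prime powers of large totient dividing \<open>k * (n choose k)\<close>\<close>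

lemma primepow_Suc_E:
  fixes d :: nat
  assumes "primepow d"
  obtains p j where "prime p" "d = p ^ Suc j"
  using assms unfolding primepow_def by (metis gr0_implies_Suc)

lemma primepow_le_2_totient:
  assumes "primepow d" shows "d \<le> 2 * totient d"
proof -
  obtain p j where d: "prime p" "d = p ^ Suc j"
    using assms by (rule primepow_Suc_E)
  have "p * p ^ j \<le> 2 * (p - 1) * p ^ j"
    using prime_ge_2_nat[OF d(1)] by (intro mult_right_mono) auto
  then show ?thesis unfolding d(2) totient_prime_power_Suc[OF d(1)] by (simp add: ac_simps)
qed

text \<open>For the \<open>t\<close> from \<open>prime_power_dvd_mult_binomial\<close>, the
  hypothesis \<open>no\<close> forces \<open>p dvd (k - 1 choose t)\<close>. Hence
  \<open>p < k\<close>, and one more factor \<open>p\<close> divides \<open>n - t\<close>.\<close>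

lemma primepow_dvd_mult_binomial:
  assumes k: "0 < k" "k \<le> n" and no: "no_large_power n k"
    and p: "prime p" and dvd: "p ^ Suc j dvd k * (n choose k)" and large: "2 * k \<le> totient (p ^ Suc j)"
  shows "p < k \<and> p ^ Suc (Suc j) \<le> n"
proof -
  obtain t where t: "t < k" "p ^ Suc j dvd n - t"
    "\<not> p dvd (k - 1 choose t) \<or> p ^ Suc (Suc j) dvd n - t"
    using prime_power_dvd_mult_binomial[OF p k dvd] by blast
  have "2 * k + p ^ j \<le> p ^ Suc j"
  proof -
    have "p ^ j * (p - 1) + p ^ j = p ^ Suc j"
      using prime_gt_0_nat[OF p] by (cases p) auto
    then show ?thesis using large unfolding totient_prime_power_Suc[OF p] by linarith
  qed
  then have pb: "p dvd (k - 1 choose t)"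
    using no p t(1,2) unfolding no_large_power_def by (meson not_le)
  then have "p ^ Suc (Suc j) dvd n - t" using t by blast
  then have "p ^ Suc (Suc j) \<le> n - t" using t(1) k by (intro dvd_imp_le) auto
  moreover have "(k - 1 choose t) dvd fact (k - 1)"
    using binomial_fact_lemma[of t "k - 1"] t(1) by (metis Suc_pred' dvd_triv_right k(1) less_Suc_eq_le)
  then have "p \<le> k - 1"
    using pb p prime_dvd_fact_iff dvd_trans by blast
  ultimately show ?thesis using k by linarith
qed

text \<open>The sum of \<open>mangoldt\<close> over the divisors of \<open>k * (n choose k)\<close>
  is split by totient; the part of small totient is contained in
  \<open>totient_psi k\<close>.\<close>

lemma ln_mult_binomial_le:
  assumes k: "0 < k" "k \<le> n"
  shows "ln (real (k * (n choose k))) \<le> totient_psi k +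
    (\<Sum>d | d dvd k * (n choose k) \<and> primepow d \<and> 2 * k \<le> totient d. mangoldt d)"
proof -
  define m where "m = k * (n choose k)"
  have m: "m \<noteq> 0" using k by (simp add: m_def)
  then have fin: "finite {d. d dvd m}" by simp
  have "ln (real m) = (\<Sum>d | d dvd m. mangoldt d)"
    using mangoldt_sum[OF m, where ?'a = real] by simp
  also have "\<dots> = (\<Sum>d | d dvd m \<and> primepow d. mangoldt d)"
    using fin by (intro sum.mono_neutral_right) (auto simp: mangoldt_def)
  also have "\<dots> = (\<Sum>d | d dvd m \<and> primepow d \<and> totient d < 2 * k. mangoldt d) +
      (\<Sum>d | d dvd m \<and> primepow d \<and> 2 * k \<le> totient d. mangoldt d)"
    using fin by (subst sum.union_disjoint[symmetric]) (auto intro!: sum.cong)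
  also have "(\<Sum>d | d dvd m \<and> primepow d \<and> totient d < 2 * k. mangoldt d :: real) \<le> totient_psi k"
    unfolding totient_psi_def
  proof (intro sum_mono2)
    show "{d. d dvd m \<and> primepow d \<and> totient d < 2 * k} \<subseteq> {d. d < 4 * k \<and> totient d < 2 * k}"
      using primepow_le_2_totient by fastforce
  qed (auto intro: mangoldt_nonneg)
  finally show ?thesis by (simp add: m_def)
qed

text \<open>A divisor of large totient would give
  \<open>n \<ge> p ^ (j + 2) \<ge> 4 * (p - 1) * p ^ j \<ge> 8 * k\<close>; the middle inequality is
  \<open>(p - 2) ^ 2 \<ge> 0\<close>.\<close>

lemma ln_mult_binomial_le_small:
  assumes k: "0 < k" "k \<le> n" and n: "n < 8 * k" and no: "no_large_power n k"
  shows "ln (real (k * (n choose k))) \<le> totient_psi k"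
proof -
  have False if d: "d dvd k * (n choose k)" "primepow d" "2 * k \<le> totient d" for d
  proof -
    obtain p j where pj: "prime p" "d = p ^ Suc j"
      using d(2) by (rule primepow_Suc_E)
    have "p ^ Suc (Suc j) \<le> n"
      using primepow_dvd_mult_binomial[OF k no pj(1)] d pj by blast
    moreover have "4 * (p - 1) \<le> p * p"
    proof -
      have "0 \<le> (int p - 2) * (int p - 2)" by simp
      then have "int (4 * (p - 1)) \<le> int (p * p)"
        using prime_gt_0_nat[OF pj(1)] by (simp add: of_nat_diff algebra_simps)
      then show ?thesis by linarith
    qed
    then have "4 * (p - 1) * p ^ j \<le> p * p * p ^ j" by (rule mult_right_mono) simp
    then have "4 * (p ^ j * (p - 1)) \<le> p ^ Suc (Suc j)" by (simp only: power_Suc ac_simps)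
    ultimately show False
      using d(3) n unfolding pj(2) totient_prime_power_Suc[OF pj(1)] by linarith
  qed
  then have "{d. d dvd k * (n choose k) \<and> primepow d \<and> 2 * k \<le> totient d} = {}" by blast
  with ln_mult_binomial_le[OF k] show ?thesis by (simp only: sum.empty)
qed

text \<open>A prime \<open>p < k\<close> contributes \<open>card J * ln p\<close>, where
  \<open>J\<close> lies between some \<open>a\<close> with
  \<open>p ^ a * (p - 1) \<ge> 2 * k\<close> and some \<open>b\<close> with
  \<open>p ^ (b + 2) \<le> n\<close>. Hence \<open>p ^ card J \<le> n / (2 * k)\<close>.\<close>

lemma ln_mult_binomial_le_large:
  assumes k: "0 < k" "2 * k \<le> n" and no: "no_large_power n k"
  shows "ln (real (k * (n choose k))) \<le>
    totient_psi k + real (card {p. prime p \<and> p < k}) * ln (real n / (2 * real k))"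
proof -
  define S where "S = {d. d dvd k * (n choose k) \<and> primepow d \<and> 2 * k \<le> totient d}"
  have "k \<le> n" using k by simp
  have fin: "finite S"
    unfolding S_def by (rule finite_subset[of _ "{d. d dvd k * (n choose k)}"]) (use k in auto)
  have S: "\<exists>p j. prime p \<and> d = p ^ Suc j \<and> p < k \<and> p ^ Suc (Suc j) \<le> n \<and> 2 * k \<le> p ^ j * (p - 1)
      \<and> aprimedivisor d = p" if "d \<in> S" for d
  proof -
    have "primepow d" using that by (simp add: S_def)
    then obtain p j where pj: "prime p" "d = p ^ Suc j" by (rule primepow_Suc_E)
    then show ?thesis
      using primepow_dvd_mult_binomial[OF k(1) \<open>k \<le> n\<close> no pj(1), of j] that
      by (intro exI[of _ p] exI[of _ j])
        (auto simp: S_def totient_prime_power_Suc aprimedivisor_prime_power simp del: power_Suc)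
  qed
  have "(\<Sum>d\<in>S. mangoldt d) = (\<Sum>p | prime p \<and> p < k. \<Sum>d | d \<in> S \<and> aprimedivisor d = p. mangoldt d :: real)"
    using fin S by (intro sum.group[symmetric]) (auto dest: S)
  also have "\<dots> \<le> (\<Sum>p | prime p \<and> p < k. ln (real n / (2 * real k)))"
  proof (intro sum_mono)
    fix p assume p: "p \<in> {p. prime p \<and> p < k}"
    then have p1: "prime p" "p > 1" using prime_gt_1_nat by auto
    define J where "J = {j. p ^ Suc j \<in> S}"
    have eq: "{d. d \<in> S \<and> aprimedivisor d = p} = (\<lambda>j. p ^ Suc j) ` J"
    proof (intro equalityI subsetI)
      fix d assume "d \<in> {d. d \<in> S \<and> aprimedivisor d = p}"
      then have d: "d \<in> S" "aprimedivisor d = p" by simp_all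
      from S[OF d(1)] d(2) obtain j where j: "d = p ^ Suc j" by metis
      show "d \<in> (\<lambda>j. p ^ Suc j) ` J"
      proof (rule image_eqI)
        show "j \<in> J" using d(1) unfolding J_def j by (rule CollectI)
      qed (rule j)
    next
      fix d assume "d \<in> (\<lambda>j. p ^ Suc j) ` J"
      then obtain j where j: "j \<in> J" "d = p ^ Suc j" by (rule imageE)
      have "d \<in> S" using j(1) unfolding j(2) J_def by (rule CollectD)
      with j(2) aprimedivisor_prime_power[OF p1(1), of "Suc j"] show "d \<in> {d. d \<in> S \<and> aprimedivisor d = p}"
        by simp
    qed
    have inj: "inj_on (\<lambda>j. p ^ Suc j) J" using p1 by (auto simp: inj_on_def)
    have "finite ((\<lambda>j. p ^ Suc j) ` J)" unfolding eq[symmetric] using fin by simp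
    then have J: "finite J" using inj by (rule finite_imageD)
    have jp: "p ^ Suc (Suc j) \<le> n \<and> 2 * k \<le> p ^ j * (p - 1)" if jJ: "j \<in> J" for j
    proof -
      obtain q i where "prime q" "p ^ Suc j = q ^ Suc i" "q ^ Suc (Suc i) \<le> n" "2 * k \<le> q ^ i * (q - 1)"
        "aprimedivisor (p ^ Suc j) = q"
        using S[OF CollectD[OF jJ[unfolded J_def]]] by metis
      moreover have "aprimedivisor (p ^ Suc j) = p" using p1 by (simp add: aprimedivisor_prime_power del: power_Suc)
      ultimately have "q = p" by simp
      with \<open>p ^ Suc j = q ^ Suc i\<close> p1(2) have "i = j" by (simp only: power_inject_exp)
      with \<open>q = p\<close> show ?thesis
        using \<open>q ^ Suc (Suc i) \<le> n\<close> \<open>2 * k \<le> q ^ i * (q - 1)\<close> by simp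
    qed
    have nk: "ln (real n / (2 * real k)) \<ge> 0" using k by (intro ln_ge_zero) auto
    have "(\<Sum>d | d \<in> S \<and> aprimedivisor d = p. mangoldt d :: real) = (\<Sum>j\<in>J. mangoldt (p ^ Suc j))"
      unfolding eq by (rule sum.reindex_cong[OF inj]) auto
    also have "\<dots> = real (card J) * ln (real p)"
      using p1 by (simp del: power_Suc)
    also have "\<dots> \<le> ln (real n / (2 * real k))"
    proof (cases "J = {}")
      case False
      define a where "a = Min J"
      define b where "b = Max J"
      have ab: "a \<in> J" "b \<in> J" "a \<le> b" using J False by (auto simp: a_def b_def)
      have "J \<subseteq> {a..b}" using J False by (auto simp: a_def b_def)
      then have "card J \<le> Suc b - a" using card_mono[of "{a..b}" J] by simp
      then have "real p ^ card J \<le> real p ^ (Suc b - a)" using p1 by (intro power_increasing) auto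
      also have "\<dots> \<le> real n / (2 * real k)"
      proof -
        have "p ^ (Suc b - a) * (2 * k) \<le> p ^ (Suc b - a) * (p ^ a * (p - 1))"
          using jp[OF ab(1)] by (intro mult_left_mono) auto
        also have "\<dots> \<le> p ^ (Suc b - a) * (p ^ a * p)"
          by (intro mult_left_mono) auto
        also have "\<dots> = p ^ Suc (Suc b)"
          using ab(3) by (simp flip: power_add power_Suc2 add: power_Suc[symmetric] del: power_Suc)
        also have "\<dots> \<le> n" using jp[OF ab(2)] by blast
        finally have "real (p ^ (Suc b - a) * (2 * k)) \<le> real n" by (rule of_nat_mono)
        then show ?thesis using k by (simp add: field_simps)
      qed
      finally have "ln (real p ^ card J) \<le> ln (real n / (2 * real k))"
        using p1 by (intro ln_mono) (auto intro!: zero_less_power)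
      then show ?thesis using p1 by (simp add: ln_realpow)
    qed (use nk in auto)
    finally show "(\<Sum>d | d \<in> S \<and> aprimedivisor d = p. mangoldt d) \<le> ln (real n / (2 * real k))" .
  qed
  also have "\<dots> = real (card {p. prime p \<and> p < k}) * ln (real n / (2 * real k))" by simp
  finally show ?thesis
    using ln_mult_binomial_le[OF k(1) \<open>k \<le> n\<close>] unfolding S_def by linarith
qed

section \<open>Chebyshev's estimates\<close>

definition psi :: "nat \<Rightarrow> real" where
  "psi n = (\<Sum>d=1..n. mangoldt d)"

text \<open>From \<open>n\<close> to \<open>n + 1\<close> the quotient \<open>n div d\<close> grows
  exactly for the divisors \<open>d\<close> of \<open>n + 1\<close>, whose \<open>mangoldt\<close>
  values add up to \<open>ln (n + 1)\<close>. The free bound \<open>N\<close> lets different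
  factorials share one range of summation.\<close>

lemma ln_fact_eq_sum_mangoldt:
  assumes "n \<le> N"
  shows "ln (fact n) = (\<Sum>d=1..N. mangoldt d * real (n div d))"
  using assms
proof (induction n)
  case (Suc n)
  have step: "real (Suc n div d) = real (n div d) + (if d dvd Suc n then 1 else 0)" for d
    by (auto simp: div_Suc dvd_eq_mod_eq_0)
  have "(\<Sum>d=1..N. mangoldt d * real (Suc n div d)) =
      (\<Sum>d=1..N. mangoldt d * real (n div d)) + (\<Sum>d=1..N. if d dvd Suc n then mangoldt d else 0)"
    unfolding step sum.distrib[symmetric] by (intro sum.cong) (auto simp: distrib_left)
  also have "(\<Sum>d=1..N. if d dvd Suc n then mangoldt d else 0 :: real) = (\<Sum>d | d dvd Suc n. mangoldt d)"
  proof (intro sum.mono_neutral_cong_right ballI)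
    show "{d. d dvd Suc n} \<subseteq> {1..N}"
    proof
      fix d assume "d \<in> {d. d dvd Suc n}"
      then have "d dvd Suc n" by simp
      then have "d \<le> Suc n" "0 < d" by (auto dest: dvd_imp_le intro: dvd_pos_nat[of "Suc n"])
      with Suc.prems show "d \<in> {1..N}" by simp
    qed
  qed auto
  also have "\<dots> = ln (real (Suc n))"
    using mangoldt_sum[of "Suc n", where ?'a = real] by simp
  also have "(\<Sum>d=1..N. mangoldt d * real (n div d)) = ln (fact n)"
    using Suc by simp
  also have "ln (fact n) + ln (real (Suc n)) = ln (fact (Suc n))"
    by (simp add: ln_mult_pos mult.commute del: of_nat_Suc)
  finally show ?case by simp
qed simp

text \<open>The logarithm of Chebyshev's quotient
  \<open>n! (n/30)! / ((n/2)! (n/3)! (n/5)!)\<close>. Since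
  \<open>1 + 1/30 = 1/2 + 1/3 + 1/5\<close>, the terms of order \<open>n ln n\<close>
  cancel.\<close>

definition chebyshev_F :: "nat \<Rightarrow> real" where
  "chebyshev_F n = ln (fact n) + ln (fact (n div 30)) - ln (fact (n div 2)) - ln (fact (n div 3)) - ln (fact (n div 5))"

text \<open>By the same identity \<open>E\<close> is a combination of fractional parts, strictly
  between -1 and 2; being an integer, it is 0 or 1.\<close>

lemma floor_combination:
  fixes m :: nat
  defines "E \<equiv> real m + real (m div 30) - real (m div 2) - real (m div 3) - real (m div 5)"
  shows "0 \<le> E" "E \<le> 1" "0 < m \<Longrightarrow> m < 6 \<Longrightarrow> E = 1"
proof -
  have "2 * (m div 2) \<le> m" "m \<le> 2 * (m div 2) + 1" "3 * (m div 3) \<le> m" "m \<le> 3 * (m div 3) + 2"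
    "5 * (m div 5) \<le> m" "m \<le> 5 * (m div 5) + 4" "30 * (m div 30) \<le> m" "m \<le> 30 * (m div 30) + 29"
    by linarith+
  then have "m div 2 + m div 3 + m div 5 \<le> m + m div 30 \<and> m + m div 30 \<le> m div 2 + m div 3 + m div 5 + 1"
    by linarith
  then show "0 \<le> E" "E \<le> 1" unfolding E_def by linarith+
  assume "0 < m" "m < 6"
  then have "m \<in> {1, 2, 3, 4, 5}" by auto
  then show "E = 1" unfolding E_def by auto
qed

lemma chebyshev_F_eq:
  "chebyshev_F n = (\<Sum>d=1..n. mangoldt d *
     (real (n div d) + real (n div d div 30) - real (n div d div 2) - real (n div d div 3) - real (n div d div 5)))"
  unfolding chebyshev_F_def
  using ln_fact_eq_sum_mangoldt[of n n] ln_fact_eq_sum_mangoldt[of "n div 30" n]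
    ln_fact_eq_sum_mangoldt[of "n div 2" n] ln_fact_eq_sum_mangoldt[of "n div 3" n]
    ln_fact_eq_sum_mangoldt[of "n div 5" n]
  by (simp add: distrib_left right_diff_distrib sum.distrib sum_subtractf div_mult2_eq[symmetric] mult.commute)

lemma chebyshev_F_le_psi: "chebyshev_F n \<le> psi n"
  unfolding chebyshev_F_eq psi_def
  by (intro sum_mono mult_right_le_one_le[OF mangoldt_nonneg] floor_combination)

text \<open>In \<open>chebyshev_F_eq\<close> the coefficient of \<open>mangoldt d\<close> is 1 for
  \<open>n div 6 < d \<le> n\<close>, where \<open>n div d\<close> is between 1 and 5, and it is
  nonnegative elsewhere.\<close>

lemma psi_le_chebyshev_F: "psi n \<le> psi (n div 6) + chebyshev_F n"
proof -
  have "psi n = psi (n div 6) + (\<Sum>d\<in>{n div 6<..n}. mangoldt d)"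
    unfolding psi_def by (subst sum.union_disjoint[symmetric]) (auto intro!: sum.cong)
  also have "(\<Sum>d\<in>{n div 6<..n}. mangoldt d) = (\<Sum>d\<in>{n div 6<..n}. mangoldt d *
     (real (n div d) + real (n div d div 30) - real (n div d div 2) - real (n div d div 3) - real (n div d div 5)))"
  proof (intro sum.cong refl)
    fix d assume d: "d \<in> {n div 6<..n}"
    have "0 < n div d" using d by (auto simp: div_greater_zero_iff)
    moreover have "n div d < 6"
      using d by (intro less_mult_imp_div_less) (auto simp: div_less_iff_less_mult mult.commute)
    ultimately show "mangoldt d = mangoldt d *
     (real (n div d) + real (n div d div 30) - real (n div d div 2) - real (n div d div 3) - real (n div d div 5))"
      by (simp only: floor_combination(3) mult_1_right)
  qed
  also have "\<dots> \<le> chebyshev_F n"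
    unfolding chebyshev_F_eq
    by (intro sum_mono2) (auto intro!: mult_nonneg_nonneg mangoldt_nonneg floor_combination(1))
  finally show ?thesis by simp
qed

section \<open>Weak Stirling bounds and numerical logarithms\<close>

lemma ln_Suc_diff_bounds:
  assumes "m > 0"
  shows "1 / (real m + 1) \<le> ln (real m + 1) - ln (real m)" "ln (real m + 1) - ln (real m) \<le> 1 / real m"
proof -
  have eq: "ln (real m + 1) - ln (real m) = ln ((real m + 1) / real m)"
    using assms by (simp add: ln_div)
  have "ln ((real m + 1) / real m) \<le> (real m + 1) / real m - 1"
    using assms by (intro ln_le_minus_one) auto
  then show "ln (real m + 1) - ln (real m) \<le> 1 / real m"
    using assms eq by (simp add: field_simps)
  have "ln (real m / (real m + 1)) \<le> real m / (real m + 1) - 1"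
    using assms by (intro ln_le_minus_one) auto
  then show "1 / (real m + 1) \<le> ln (real m + 1) - ln (real m)"
    using assms by (simp add: ln_div field_simps)
qed

lemma ln_fact_bounds:
  assumes "m > 0"
  shows "real m * ln m - m + 1 \<le> ln (fact m)" "ln (fact m) \<le> real m * ln m - m + 1 + ln m"
proof -
  have "real m * ln m - m + 1 \<le> ln (fact m) \<and> ln (fact m) \<le> real m * ln m - m + 1 + ln m"
    using assms
  proof (induction m rule: nat_induct_non_zero)
    case (Suc m)
    have step: "ln (fact (Suc m)) = ln (real m + 1) + ln (fact m)"
      by (simp add: ln_mult_pos add.commute)
    have "real m * (ln (real m + 1) - ln (real m)) \<le> 1"
      using ln_Suc_diff_bounds(2)[OF Suc.hyps] Suc.hyps by (simp add: field_simps)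
    moreover have "1 \<le> (real m + 1) * (ln (real m + 1) - ln (real m))"
      using ln_Suc_diff_bounds(1)[OF Suc.hyps] Suc.hyps by (simp add: field_simps)
    ultimately show ?case
      using Suc.IH unfolding step by (simp add: algebra_simps)
  qed simp
  then show "real m * ln m - m + 1 \<le> ln (fact m)" "ln (fact m) \<le> real m * ln m - m + 1 + ln m" by auto
qed

lemma x_ln_x_mono:
  fixes x y :: real
  assumes "1 \<le> x" "x \<le> y"
  shows "x * ln x - x \<le> y * ln y - y"
proof -
  have "ln (x / y) \<le> x / y - 1" using assms by (intro ln_le_minus_one) auto
  then have "y * (ln x - ln y) \<le> x - y"
    using assms by (simp add: ln_div field_simps)
  moreover have "(y - x) * ln x \<ge> 0" using assms by simp
  ultimately show ?thesis by (simp add: algebra_simps)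
qed

text \<open>Replaces the factorial of the integer part of \<open>y\<close> by a smooth function, at
  the cost of \<open>ln (y + 1)\<close> in either direction.\<close>

lemma ln_fact_floor_bounds:
  fixes y :: real
  assumes y: "0 < y" "real m \<le> y" "y < real m + 1"
  shows "ln (fact m) \<le> y * ln y - y + 1 + ln (y + 1)"
    and "1 \<le> y \<Longrightarrow> y * ln y - y + 1 - ln (y + 1) \<le> ln (fact m)"
proof -
  show "ln (fact m) \<le> y * ln y - y + 1 + ln (y + 1)"
  proof (cases "m = 0")
    case True
    have "ln (1 / y) \<le> 1 / y - 1" using y by (intro ln_le_minus_one) auto
    then have "y - 1 \<le> y * ln y" using y by (simp add: ln_div field_simps)
    moreover have "ln (y + 1) \<ge> 0" using y by simp
    ultimately show ?thesis using True by simp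
  next
    case False
    then have "ln (fact m) \<le> real m * ln m - m + 1 + ln m" by (intro ln_fact_bounds) simp
    moreover have "real m * ln m - m \<le> y * ln y - y"
      using False y by (intro x_ln_x_mono) auto
    moreover have "ln m \<le> ln (y + 1)" using False y by simp
    ultimately show ?thesis by simp
  qed
  \<comment> \<open>Since \<open>y < m + 1\<close>, the lower bound goes through
    \<open>(m + 1)!\<close>.\<close>
  assume "1 \<le> y"
  then have "y * ln y - y \<le> (real m + 1) * ln (real m + 1) - (real m + 1)"
    using y by (intro x_ln_x_mono) auto
  also have "\<dots> + 1 \<le> ln (fact (Suc m))"
    using ln_fact_bounds(1)[of "Suc m"] by (simp add: add.commute)
  also have "ln (fact (Suc m)) = ln (real m + 1) + ln (fact m)"
    by (simp add: ln_mult_pos add.commute)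
  also have "ln (real m + 1) \<le> ln (y + 1)" using y by simp
  finally show "y * ln y - y + 1 - ln (y + 1) \<le> ln (fact m)" by simp
qed

lemma ln_fact_div_bounds:
  assumes "n > 0" "a > 0"
  shows "ln (fact (n div a)) \<le> real n / a * (ln n - ln a) - real n / a + 1 + ln (real n / a + 1)"
    and "a \<le> n \<Longrightarrow> real n / a * (ln n - ln a) - real n / a + 1 - ln (real n / a + 1) \<le> ln (fact (n div a))"
proof -
  have "real n < real (a + n div a * a)" "real (n div a * a) \<le> real n"
    unfolding of_nat_less_iff of_nat_le_iff using dividend_less_div_times[OF assms(2), of n] by simp_all
  then have y: "0 < real n / a" "real (n div a) \<le> real n / a" "real n / a < real (n div a) + 1"
    using assms by (simp_all add: field_simps)
  have eq: "ln (real n / a) = ln n - ln a" using assms by (simp add: ln_div)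
  show "ln (fact (n div a)) \<le> real n / a * (ln n - ln a) - real n / a + 1 + ln (real n / a + 1)"
    using ln_fact_floor_bounds(1)[OF y] by (simp add: eq)
  assume "a \<le> n"
  then show "real n / a * (ln n - ln a) - real n / a + 1 - ln (real n / a + 1) \<le> ln (fact (n div a))"
    using ln_fact_floor_bounds(2)[OF y] assms by (simp add: eq)
qed

text \<open>Chebyshev's constant
  \<open>ln (2 ^ (1/2) * 3 ^ (1/3) * 5 ^ (1/5) / 30 ^ (1/30))\<close>.\<close>

definition chebyshev_A :: real where
  "chebyshev_A = 14/30 * ln 2 + 9/30 * ln 3 + 5/30 * ln 5"

definition chebyshev_err :: "nat \<Rightarrow> real" where
  "chebyshev_err n = ln (real n + 1) + ln (real n / 2 + 1) + ln (real n / 3 + 1) + ln (real n / 5 + 1) + ln (real n / 30 + 1)"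

lemma ln_30: "ln (30::real) = ln 2 + ln 3 + ln 5"
proof -
  have "ln (30::real) = ln (2 * 3 * 5)" by simp
  also have "\<dots> = ln 2 + ln 3 + ln 5" by (simp only: ln_mult_pos)
  finally show ?thesis .
qed

lemma chebyshev_F_upper:
  assumes "n \<ge> 5"
  shows "chebyshev_F n \<le> chebyshev_A * n - 1 + chebyshev_err n"
  using ln_fact_div_bounds(1)[of n 1] ln_fact_div_bounds(1)[of n 30] ln_fact_div_bounds(2)[of n 2]
    ln_fact_div_bounds(2)[of n 3] ln_fact_div_bounds(2)[of n 5] assms
  unfolding chebyshev_F_def chebyshev_A_def chebyshev_err_def
  by (simp add: ln_30 algebra_simps)

lemma chebyshev_F_lower:
  assumes "n \<ge> 30"
  shows "chebyshev_A * n - 1 - chebyshev_err n \<le> chebyshev_F n"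
  using ln_fact_div_bounds(2)[of n 1] ln_fact_div_bounds(2)[of n 30] ln_fact_div_bounds(1)[of n 2]
    ln_fact_div_bounds(1)[of n 3] ln_fact_div_bounds(1)[of n 5] assms
  unfolding chebyshev_F_def chebyshev_A_def chebyshev_err_def
  by (simp add: ln_30 algebra_simps)

lemma ln_2_bounds: "0.6931 < ln (2::real)" "ln (2::real) < 0.6932"
  using ln_approx_bounds[of 2 4] by (simp_all add: eval_nat_numeral)

lemma ln_3_bounds: "1.0985 < ln (3::real)" "ln (3::real) < 1.0987"
proof -
  have "ln (3::real) = ln 2 + ln (3 / 2)" by (simp add: ln_div)
  then show "1.0985 < ln (3::real)" "ln (3::real) < 1.0987"
    using ln_2_bounds ln_approx_bounds[of "3/2" 3] by (simp_all add: eval_nat_numeral)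
qed

lemma ln_4: "ln (4::real) = 2 * ln 2"
  using ln_realpow[of 2 2] by simp

lemma ln_5_bounds: "1.6093 < ln (5::real)" "ln (5::real) < 1.6096"
proof -
  have "ln (5::real) = 2 * ln 2 + ln (5 / 4)" by (simp add: ln_div ln_4)
  then show "1.6093 < ln (5::real)" "ln (5::real) < 1.6096"
    using ln_2_bounds ln_approx_bounds[of "5/4" 2] by (simp_all add: eval_nat_numeral)
qed

lemma chebyshev_A_bounds: "0.921 < chebyshev_A" "chebyshev_A < 0.9216"
  using ln_2_bounds ln_3_bounds ln_5_bounds by (simp_all add: chebyshev_A_def)

lemma chebyshev_err_le:
  assumes "n \<ge> 6"
  shows "chebyshev_err n \<le> 5 * ln n - 3.5"
proof -
  define x where "x = real n"
  have x: "x \<ge> 6" using assms by (simp add: x_def)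
  have "chebyshev_err n = ln ((x + 1) * (x / 2 + 1) * (x / 3 + 1) * (x / 5 + 1) * (x / 30 + 1))"
    unfolding chebyshev_err_def x_def[symmetric] using x
    by (simp add: ln_mult_pos add_pos_pos zero_less_mult_iff)
  \<comment> \<open>For \<open>x \<ge> 6\<close> each factor \<open>x / a + 1\<close> is at most
    \<open>(1 / a + 1 / 6) * x\<close>. The product \<open>77 / 2700\<close> of these constants is
    rounded up to \<open>4 / 135\<close>, whose logarithm is a combination of those of 2, 3 and
    5.\<close>
  also have "\<dots> \<le> ln (4 / (3 ^ 3 * 5) * x ^ 5)"
  proof (rule ln_mono)
    have "(x + 1) * (x / 2 + 1) * (x / 3 + 1) * (x / 5 + 1) * (x / 30 + 1) \<le>
        (7/6 * x) * (2/3 * x) * (1/2 * x) * (11/30 * x) * (1/5 * x)"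
      using x by (intro mult_mono) auto
    also have "\<dots> = 77/2700 * x ^ 5" by (simp add: eval_nat_numeral)
    also have "\<dots> \<le> 4 / (3 ^ 3 * 5) * x ^ 5" using x by (intro mult_right_mono) auto
    finally show "(x + 1) * (x / 2 + 1) * (x / 3 + 1) * (x / 5 + 1) * (x / 30 + 1) \<le>
        4 / (3 ^ 3 * 5) * x ^ 5" .
  qed (use x in \<open>auto intro!: mult_pos_pos add_pos_pos\<close>)
  also have "\<dots> = ln (4 / (3 ^ 3 * 5)) + 5 * ln x"
    using x by (subst ln_mult_pos) (auto simp: ln_realpow)
  also have "ln (4 / (3 ^ 3 * 5) :: real) = 2 * ln 2 - (3 * ln 3 + ln 5)"
    by (subst ln_div) (simp_all add: ln_4 ln_mult_pos ln_realpow del: power_numeral)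
  also have "\<dots> \<le> - 3.5"
    using ln_2_bounds ln_3_bounds ln_5_bounds by simp
  finally show ?thesis by (simp add: x_def)
qed

section \<open>Bounds for \<open>psi\<close> and primes in short intervals\<close>

text \<open>Iterates \<open>psi_le_chebyshev_F\<close> along \<open>n\<close>,
  \<open>n div 6\<close> and so on. The geometric series gives the factor \<open>6/5\<close>; the
  quadratic term absorbs the logarithmic error of each step because \<open>ln n\<close> drops by
  more than 1.79.\<close>

lemma psi_upper:
  assumes "n \<ge> 1"
  shows "psi n \<le> 6/5 * chebyshev_A * n + 3/2 * (ln n)\<^sup>2"
  using assms
proof (induction n rule: less_induct)
  case (less n)
  show ?case
  proof (cases "n < 6")
    case True
    then have "psi n \<le> chebyshev_F n"
      using psi_le_chebyshev_F[of n] by (simp add: psi_def)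
    also have "\<dots> \<le> 6/5 * chebyshev_A * n"
    proof -
      have *: "ln (6::real) = ln 2 + ln 3" "ln (24::real) = 3 * ln 2 + ln 3" "ln (120::real) = 3 * ln 2 + ln 3 + ln 5"
        using ln_mult_pos[of "2::real" 3] ln_mult_pos[of "2 ^ 3::real" 3] ln_mult_pos[of "2 ^ 3 * 3::real" 5]
          ln_realpow[of 2 3] by simp_all
      from True less.prems have "n \<in> {1, 2, 3, 4, 5}" by auto
      then show ?thesis
        using ln_2_bounds ln_3_bounds ln_5_bounds chebyshev_A_bounds
        by (auto simp: chebyshev_F_def fact_numeral *)
    qed
    finally show ?thesis by (rule order_trans) simp
  next
    case False
    define m where "m = n div 6"
    have m: "m \<ge> 1" "m < n" "real m \<le> real n / 6" using False by (auto simp: m_def of_nat_div_le_of_nat)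
    define L where "L = ln (real n)"
    have "ln (6::real) = ln 2 + ln 3" using ln_mult_pos[of "2::real" 3] by simp
    then have l6: "1.79 < ln (6::real)" using ln_2_bounds ln_3_bounds by simp
    have L: "L \<ge> 1.79" using False l6 ln_mono[of 6 "real n"] unfolding L_def by linarith
    have "ln (real m) \<le> ln (real n / 6)" using m by (intro ln_mono) auto
    also have "\<dots> \<le> L - 1.79" using False l6 by (simp add: ln_div L_def)
    finally have "(ln (real m))\<^sup>2 \<le> (L - 1.79)\<^sup>2" using m(1) by (intro power_mono) auto
    moreover have "psi m \<le> 6/5 * chebyshev_A * m + 3/2 * (ln m)\<^sup>2" by (rule less.IH) (use m in auto)
    moreover have "6/5 * chebyshev_A * m \<le> 6/5 * chebyshev_A * (real n / 6)"
      using m chebyshev_A_bounds by (intro mult_left_mono) auto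
    moreover have "chebyshev_F n \<le> chebyshev_A * n - 4.5 + 5 * L"
      using chebyshev_F_upper[of n] chebyshev_err_le[of n] False by (simp add: L_def)
    ultimately have "psi n \<le> 6/5 * chebyshev_A * n + 3/2 * (L - 1.79)\<^sup>2 - 4.5 + 5 * L"
      using psi_le_chebyshev_F[of n] by (simp add: m_def)
    \<comment> \<open>The left side minus the right side is
      \<open>0.30615 - 0.37 * L\<close>.\<close>
    moreover have "3/2 * (L - 1.79)\<^sup>2 - 4.5 + 5 * L \<le> 3/2 * L\<^sup>2"
      using L by (simp add: power2_eq_square algebra_simps)
    ultimately show ?thesis unfolding L_def by linarith
  qed
qed

text \<open>The prime powers in \<open>S\<close> have exponent at least 2, so their primes are at
  most \<open>r\<close>. Distinct powers of one prime differ by a factor of at least 2, too much for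
  the range from \<open>m + 1\<close> to \<open>2 * m + 1\<close>, so each prime counts at most
  once.\<close>

lemma sum_mangoldt_nonprime_le:
  assumes S: "finite S" "\<And>d. d \<in> S \<Longrightarrow> m < d \<and> d \<le> 2 * m + 1 \<and> \<not> prime d \<and> d < (r + 1)\<^sup>2"
  shows "(\<Sum>d\<in>S. mangoldt d) \<le> psi r"
proof -
  define S' where "S' = {d \<in> S. primepow d}"
  have S': "\<exists>j. prime (aprimedivisor d) \<and> 2 \<le> j \<and> d = aprimedivisor d ^ j" if d: "d \<in> S'" for d
  proof -
    obtain p j where pj: "prime p" "j > 0" "d = p ^ j"
      using d unfolding S'_def primepow_def by auto
    then have "aprimedivisor d = p" by (simp add: aprimedivisor_prime_power)
    moreover have "j \<noteq> 1" using S(2)[of d] d pj by (auto simp: S'_def)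
    ultimately show ?thesis using pj by (intro exI[of _ j]) auto
  qed
  have inj: "inj_on aprimedivisor S'"
  proof (rule inj_onI)
    fix d e assume de: "d \<in> S'" "e \<in> S'" "aprimedivisor d = aprimedivisor e"
    obtain p i j where p: "prime p" and d: "d = p ^ i" and e: "e = p ^ j"
      using S'[OF de(1)] S'[OF de(2)] de(3) by metis
    have less: False if "i < j" "p ^ j \<le> 2 * m + 1" "m < p ^ i" for i j
    proof -
      have "2 * p ^ i \<le> p * p ^ i" using prime_ge_2_nat[OF p] by (intro mult_right_mono) auto
      also have "\<dots> = p ^ Suc i" by simp
      also have "\<dots> \<le> p ^ j" using that prime_gt_0_nat[OF p] by (intro power_increasing) auto
      finally show False using that by linarith
    qed
    have "i = j"
      using less[of i j] less[of j i] S(2)[of d] S(2)[of e] de d e unfolding S'_def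
      by (metis (no_types, lifting) linorder_neqE_nat mem_Collect_eq)
    then show "d = e" using d e by simp
  qed
  have le: "prime (aprimedivisor d) \<and> aprimedivisor d \<le> r" if "d \<in> S'" for d
  proof -
    obtain j where j: "prime (aprimedivisor d)" "2 \<le> j" "d = aprimedivisor d ^ j" using S'[OF \<open>d \<in> S'\<close>] by auto
    have "aprimedivisor d ^ 2 \<le> aprimedivisor d ^ j"
      using j prime_gt_0_nat[OF j(1)] by (intro power_increasing) auto
    also have "\<dots> < (r + 1)\<^sup>2" using S(2)[of d] that j(3) by (simp add: S'_def)
    finally have "aprimedivisor d < r + 1" by (rule power_less_imp_less_base) simp
    with j show ?thesis by simp
  qed
  have "(\<Sum>d\<in>S. mangoldt d :: real) = (\<Sum>d\<in>S'. mangoldt d)"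
    using S(1) by (intro sum.mono_neutral_right) (auto simp: S'_def mangoldt_def)
  also have "\<dots> = (\<Sum>d\<in>S'. mangoldt (aprimedivisor d))"
    using le by (intro sum.cong refl) (auto simp: S'_def mangoldt_def)
  also have "\<dots> = (\<Sum>p\<in>aprimedivisor ` S'. mangoldt p)"
    by (simp add: sum.reindex[OF inj])
  also have "\<dots> \<le> psi r"
    unfolding psi_def using le prime_gt_0_nat
    by (intro sum_mono2) (fastforce simp: Suc_le_eq intro: mangoldt_nonneg)+
  finally show ?thesis .
qed

lemma ln_le_tangent:
  assumes "(0::real) < a" "0 < x"
  shows "ln x \<le> ln a - 1 + x / a"
proof -
  have "ln (x / a) \<le> x / a - 1" using assms by (intro ln_le_minus_one) auto
  then show ?thesis using assms by (simp add: ln_div)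
qed

text \<open>Without such a prime, \<open>psi\<close> grows between \<open>4 * n / 5\<close> and
  \<open>n\<close> only by proper prime powers, hence by at most \<open>psi r\<close> with
  \<open>r\<close> about the square root of \<open>n\<close>. This contradicts Chebyshev's bounds
  because \<open>6/5 * 4/5 < 1\<close>.\<close>

lemma exists_prime_four_fifths:
  fixes n :: nat
  assumes n: "n \<ge> 20736"
  shows "\<exists>p. prime p \<and> p \<le> n \<and> 4 * n \<le> 5 * p"
proof (rule ccontr)
  assume contr: "\<not> ?thesis"
  \<comment> \<open>The largest integer below \<open>4 * n / 5\<close>.\<close>
  define m where "m = (4 * n - 1) div 5"
  define r where "r = nat \<lfloor>sqrt n\<rfloor>"
  define s where "s = sqrt (sqrt n)"
  define L where "L = ln (real n)"
  have m: "5 * m < 4 * n" "4 * n \<le> 5 * m + 5" "m \<le> n" "n \<le> 2 * m + 1" "m \<ge> 1"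
    using n by (auto simp: m_def)
  have r: "real r \<le> sqrt n" "sqrt n < real r + 1"
    by (auto simp: r_def)
  \<comment> \<open>\<open>20736 = 12 ^ 4\<close>; all error terms are compared with powers of the
    fourth root \<open>s\<close> of \<open>n\<close>.\<close>
  have s: "s \<ge> 12"
    unfolding s_def using n by (intro real_le_rsqrt) (auto intro!: real_le_rsqrt)
  have s2: "s\<^sup>2 = sqrt n" by (simp add: s_def)
  have s4: "real n = s ^ 4"
  proof -
    have "s ^ 4 = (s\<^sup>2)\<^sup>2" by (simp flip: power_mult)
    then show ?thesis by (simp add: s2)
  qed
  have "n < (r + 1)\<^sup>2"
  proof -
    have "(sqrt n)\<^sup>2 < (real r + 1)\<^sup>2" using r(2) by (intro power_strict_mono) auto
    then have "real n < real ((r + 1)\<^sup>2)" by (simp add: add.commute)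
    then show ?thesis by (simp only: of_nat_less_iff)
  qed
  then have "(\<Sum>d\<in>{m<..n}. mangoldt d) \<le> psi r"
    using contr m by (intro sum_mangoldt_nonprime_le[where m = m]) auto
  moreover have "psi n = psi m + (\<Sum>d\<in>{m<..n}. mangoldt d)"
    unfolding psi_def using m by (subst sum.union_disjoint[symmetric]) (auto intro!: sum.cong)
  ultimately have "psi n \<le> psi m + psi r" by simp
  have "ln (12::real) = 2 * ln 2 + ln 3" using ln_mult_pos[of "4::real" 3] by (simp add: ln_4)
  then have "ln s \<le> 1.4851 + s / 12"
    using ln_le_tangent[of 12 s] s ln_2_bounds ln_3_bounds by simp
  moreover have "L = 4 * ln s" using s by (simp add: L_def s4 ln_realpow)
  ultimately have L: "L \<le> 0.84 * s" using s by simp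
  have L0: "L \<ge> 0" using n by (simp add: L_def)
  have "ln (real m) \<le> L" unfolding L_def using m by (intro ln_mono) auto
  then have "(ln (real m))\<^sup>2 \<le> L\<^sup>2" using m by (intro power_mono) auto
  moreover have "psi m \<le> 6/5 * chebyshev_A * m + 3/2 * (ln m)\<^sup>2" using m by (intro psi_upper)
  moreover have "6/5 * chebyshev_A * m \<le> 6/5 * chebyshev_A * (4/5 * n)"
    using m chebyshev_A_bounds by (intro mult_left_mono) auto
  ultimately have psi_m: "psi m \<le> 24/25 * chebyshev_A * n + 3/2 * L\<^sup>2" by simp
  have r1: "r \<ge> 1" using r(2) s s2 power_mono[of 12 s 2] by simp
  have "ln (real r) \<le> ln (sqrt n)" using r r1 by (intro ln_mono) auto
  also have "\<dots> = L / 2" using n by (simp add: L_def ln_sqrt)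
  finally have "(ln (real r))\<^sup>2 \<le> (L / 2)\<^sup>2" using r1 by (intro power_mono) auto
  moreover have "psi r \<le> 6/5 * chebyshev_A * r + 3/2 * (ln r)\<^sup>2" using r1 by (intro psi_upper)
  moreover have "6/5 * chebyshev_A * r \<le> 1.106 * s\<^sup>2"
    using r chebyshev_A_bounds unfolding s2 by (intro mult_mono) auto
  ultimately have psi_r: "psi r \<le> 1.106 * s\<^sup>2 + 3/8 * L\<^sup>2" by (simp add: power_divide)
  have "chebyshev_A * n - 1 - (5 * L - 3.5) \<le> psi n"
    using chebyshev_F_lower[of n] chebyshev_F_le_psi[of n] chebyshev_err_le[of n] n by (simp add: L_def)
  with \<open>psi n \<le> psi m + psi r\<close> psi_m psi_r
  have "chebyshev_A * n / 25 \<le> 5 * L + 15/8 * L\<^sup>2 + 1.106 * s\<^sup>2" by simp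
  moreover have "0.92 * real n \<le> chebyshev_A * n" using chebyshev_A_bounds by (intro mult_right_mono) auto
  \<comment> \<open>By the bounds that follow, the right side is at most
    \<open>2.78 * s ^ 2\<close>, while \<open>s \<ge> 12\<close> makes the left side at least
    \<open>5.29 * s ^ 2\<close>.\<close>
  ultimately have "0.0368 * s ^ 4 \<le> 5 * L + 15/8 * L\<^sup>2 + 1.106 * s\<^sup>2" by (simp add: s4)
  moreover have "L\<^sup>2 \<le> 0.7056 * s\<^sup>2"
    using power_mono[OF L L0, of 2] by (simp add: power2_eq_square)
  moreover have "12 * s \<le> s\<^sup>2" using s by (simp add: power2_eq_square)
  moreover have "12\<^sup>2 * s\<^sup>2 \<le> s ^ 4"
    using power_mono[OF s, of 2] mult_right_mono[of "12\<^sup>2" "s\<^sup>2" "s\<^sup>2"] by (simp flip: power_add)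
  ultimately show False using L s by simp
qed

section \<open>Lower bounds for binomial coefficients\<close>

text \<open>Beyond \<open>2 * k\<close> a totient below \<open>2 * k\<close> rules out primes, and
  the range up to \<open>4 * k\<close> fits \<open>sum_mangoldt_nonprime_le\<close>.\<close>

lemma totient_psi_le_psi:
  assumes k: "k > 0" and r: "4 * k \<le> (r + 1)\<^sup>2"
  shows "totient_psi k \<le> psi (2 * k) + psi r"
proof -
  define S where "S = {d. d < 4 * k \<and> totient d < 2 * k}"
  have fin: "finite S" by (rule finite_subset[of _ "{..<4 * k}"]) (auto simp: S_def)
  have "totient_psi k = (\<Sum>d\<in>{d\<in>S. d \<le> 2 * k}. mangoldt d) + (\<Sum>d\<in>{d\<in>S. 2 * k < d}. mangoldt d)"
    unfolding totient_psi_def S_def[symmetric] using fin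
    by (subst sum.union_disjoint[symmetric]) (auto intro!: sum.cong)
  also have "(\<Sum>d\<in>{d\<in>S. d \<le> 2 * k}. mangoldt d) = (\<Sum>d\<in>{d\<in>S. d \<le> 2 * k} - {0}. mangoldt d :: real)"
    using fin by (intro sum.mono_neutral_right) auto
  also have "\<dots> \<le> psi (2 * k)"
    unfolding psi_def by (intro sum_mono2) (auto intro: mangoldt_nonneg)
  also have "(\<Sum>d\<in>{d\<in>S. 2 * k < d}. mangoldt d) \<le> psi r"
  proof (rule sum_mangoldt_nonprime_le[where m = "2 * k"])
    fix d assume d: "d \<in> {d\<in>S. 2 * k < d}"
    then have "\<not> prime d" by (auto simp: S_def totient_prime)
    with d r show "2 * k < d \<and> d \<le> 2 * (2 * k) + 1 \<and> \<not> prime d \<and> d < (r + 1)\<^sup>2"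
      by (auto simp: S_def)
  qed (use fin in auto)
  finally show ?thesis by simp
qed

text \<open>The main term is \<open>2.212 * k\<close>; the slack up to \<open>12/5 * k\<close> and
  the constant 80 absorb the square root and the logarithms. With \<open>w\<close> the fourth root
  of \<open>4 * k\<close> this becomes a quartic inequality.\<close>

lemma totient_psi_le_linear:
  assumes k: "k > 0"
  shows "totient_psi k \<le> 12/5 * k + 80"
proof -
  define w where "w = sqrt (sqrt (4 * real k))"
  define r where "r = nat \<lfloor>sqrt (4 * real k)\<rfloor>"
  define L where "L = ln (4 * real k)"
  have w2: "w\<^sup>2 = sqrt (4 * real k)" by (simp add: w_def)
  have w4: "w ^ 4 = 4 * real k"
  proof -
    have "w ^ 4 = (w\<^sup>2)\<^sup>2" by (simp flip: power_mult)
    then show ?thesis unfolding w2 by simp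
  qed
  have w0: "w > 0" using k by (simp add: w_def)
  have r: "real r \<le> w\<^sup>2" "w\<^sup>2 < real r + 1" unfolding w2 by (auto simp: r_def)
  have "4 * k \<le> (r + 1)\<^sup>2"
  proof -
    have "(w\<^sup>2)\<^sup>2 \<le> (real r + 1)\<^sup>2" using r(2) by (intro power_mono) auto
    then have "real (4 * k) \<le> real ((r + 1)\<^sup>2)" using w4 by (simp add: add.commute flip: power_mult)
    then show ?thesis by (simp only: of_nat_le_iff)
  qed
  then have totient_psi: "totient_psi k \<le> psi (2 * k) + psi r" using k by (intro totient_psi_le_psi)
  have "1 \<le> sqrt (4 * real k)" using k by simp
  then have r1: "r \<ge> 1" by (simp add: r_def le_nat_iff)
  have L0: "0 \<le> L" using k by (simp add: L_def)
  have "ln (real (2 * k)) \<le> L" using k by (simp add: L_def)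
  then have "(ln (real (2 * k)))\<^sup>2 \<le> L\<^sup>2" using k by (intro power_mono) auto
  moreover have "psi (2 * k) \<le> 6/5 * chebyshev_A * real (2 * k) + 3/2 * (ln (real (2 * k)))\<^sup>2"
    using k by (intro psi_upper) simp
  moreover have "6/5 * chebyshev_A * real (2 * k) \<le> 1.106 * real (2 * k)"
    using chebyshev_A_bounds by (intro mult_right_mono) auto
  ultimately have 1: "psi (2 * k) \<le> 2.212 * k + 3/2 * L\<^sup>2" by simp
  have "ln (real r) \<le> ln (sqrt (4 * real k))" using r r1 w2 by (intro ln_mono) auto
  also have "\<dots> = L / 2" using k by (simp add: L_def ln_sqrt)
  finally have "(ln (real r))\<^sup>2 \<le> (L / 2)\<^sup>2" using r1 by (intro power_mono) auto
  moreover have "psi r \<le> 6/5 * chebyshev_A * r + 3/2 * (ln r)\<^sup>2" using r1 by (intro psi_upper)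
  moreover have "6/5 * chebyshev_A * r \<le> 1.106 * w\<^sup>2"
    using r chebyshev_A_bounds by (intro mult_mono) auto
  ultimately have 2: "psi r \<le> 1.106 * w\<^sup>2 + 3/8 * L\<^sup>2" by (simp add: power_divide)
  \<comment> \<open>The tangent is taken at 5, near the minimum of the final quartic.\<close>
  have "ln w \<le> ln 5 - 1 + w / 5" using w0 by (intro ln_le_tangent) auto
  moreover have "L = 4 * ln w" unfolding L_def w4[symmetric] using w0 by (simp add: ln_realpow)
  ultimately have "L \<le> 2.4384 + 0.8 * w" using ln_5_bounds by simp
  then have "L\<^sup>2 \<le> (2.4384 + 0.8 * w)\<^sup>2" using L0 by (intro power_mono)
  also have "\<dots> \<le> 5.95 + 3.9015 * w + 0.64 * w\<^sup>2"
    using w0 by (simp add: power2_eq_square algebra_simps)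
  finally have "totient_psi k \<le> 0.553 * w ^ 4 + 11.2 + 7.316 * w + 2.306 * w\<^sup>2"
    using totient_psi 1 2 w0 w4 by simp
  \<comment> \<open>a sum of squares certificate for the quartic below, whose minimum is near \<open>w = 5.6\<close>\<close>
  moreover have "0 \<le> 0.047 * (w\<^sup>2 - 31.5)\<^sup>2 + 0.655 * (w - 5.585)\<^sup>2" by simp
  then have "0 \<le> 0.047 * w ^ 4 - 2.306 * w\<^sup>2 - 7.316 * w + 67.1"
    using w0 by (simp add: power2_eq_square power4_eq_xxxx algebra_simps)
  ultimately have "totient_psi k \<le> 0.6 * w ^ 4 + 80" by simp
  then show ?thesis by (simp add: w4)
qed

lemma prime_mod_6:
  fixes p :: nat
  assumes "prime p"
  shows "p = 2 \<or> p = 3 \<or> p mod 6 = 1 \<or> p mod 6 = 5"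
proof -
  define r where "r = p mod 6"
  have p: "p = 6 * (p div 6) + r" by (simp add: r_def)
  have "2 dvd p" if "2 dvd r" by (subst p, rule dvd_add[OF _ that]) simp
  moreover have "3 dvd p" if "3 dvd r" by (subst p, rule dvd_add[OF _ that]) simp
  moreover have "p = 2" if "2 dvd p"
    using primes_dvd_imp_eq[OF two_is_prime_nat assms that] by simp
  moreover have "p = 3" if "3 dvd p"
    using primes_dvd_imp_eq[OF _ assms that] by simp
  moreover have "r < 6" by (simp add: r_def)
  then have "r = 0 \<or> r = 1 \<or> r = 2 \<or> r = 3 \<or> r = 4 \<or> r = 5" by linarith
  then have "2 dvd r \<or> 3 dvd r \<or> r = 1 \<or> r = 5" by (elim disjE) simp_all
  ultimately show ?thesis unfolding r_def[symmetric] by blast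
qed

text \<open>Apart from 2 and 3, primes are 1 or 5 modulo 6, and 1 itself is not prime.\<close>

lemma card_primes_below: "3 * card {p. prime p \<and> p < (k::nat)} \<le> k + 5"
proof (cases "k < 2")
  case True
  then have "{p. prime p \<and> p < k} = {}" by (auto dest: prime_gt_1_nat)
  then show ?thesis by (simp only: card.empty)
next
  case False
  define R where "R = {m. m < k \<and> (m mod 6 = 1 \<or> m mod 6 = 5)}"
  have fin: "finite R" by (rule finite_subset[of _ "{..<k}"]) (auto simp: R_def)
  \<comment> \<open>The first quotient counts the residue 1, the second the residue 5.\<close>
  have "card {m. m < k \<and> (m mod 6 = 1 \<or> m mod 6 = 5)} = (k + 4) div 6 + k div 6" for k :: nat
  proof (induction k)
    case (Suc k)
    let ?P = "\<lambda>m. m mod 6 = 1 \<or> m mod 6 = (5::nat)"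
    have "{m. m < Suc k \<and> ?P m} = (if ?P k then insert k {m. m < k \<and> ?P m} else {m. m < k \<and> ?P m})"
      by (auto simp: less_Suc_eq)
    then have "card {m. m < Suc k \<and> ?P m} = card {m. m < k \<and> ?P m} + (if ?P k then 1 else 0)"
      by (simp add: card_insert_if)
    also have "\<dots> = (Suc k + 4) div 6 + Suc k div 6"
    proof -
      have "Suc k div 6 = k div 6 + (if k mod 6 = 5 then 1 else 0)" by presburger
      moreover have "(Suc k + 4) div 6 = (k + 4) div 6 + (if k mod 6 = 1 then 1 else 0)" by presburger
      ultimately show ?thesis unfolding Suc.IH by (simp split: if_splits)
    qed
    finally show ?case .
  qed simp
  then have R: "card R = (k + 4) div 6 + k div 6" unfolding R_def .
  have "{p. prime p \<and> p < k} \<subseteq> insert 2 (insert 3 (R - {1}))"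
  proof
    fix p assume p: "p \<in> {p. prime p \<and> p < k}"
    then have pp: "prime p" "p < k" by simp_all
    have "p = 2 \<or> p = 3 \<or> p mod 6 = 1 \<or> p mod 6 = 5" by (rule prime_mod_6[OF pp(1)])
    moreover have "p \<noteq> 1" using pp(1) by (rule contrapos_pn) simp
    ultimately show "p \<in> insert 2 (insert 3 (R - {1}))"
      using pp(2) unfolding R_def by blast
  qed
  then have "card {p. prime p \<and> p < k} \<le> card (insert 2 (insert 3 (R - {1})))"
    using fin by (intro card_mono) auto
  also have "\<dots> \<le> Suc (Suc (card (R - {1})))"
    using fin by (simp add: card_insert_if)
  also have "card (R - {1}) = card R - 1"
    using False fin by (intro card_Diff_singleton) (auto simp: R_def)
  finally show ?thesis using R False by linarith
qed

text \<open>The terms of the binomial expansion of \<open>n ^ n = (k + (n - k)) ^ n\<close> increase up to the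
  index \<open>k\<close> and decrease afterwards.\<close>

lemma power_self_le_binomial:
  fixes n k :: nat
  assumes k: "k \<le> n"
  shows "n ^ n \<le> (n + 1) * ((n choose k) * k ^ k * (n - k) ^ (n - k))"
proof -
  define t where "t i = (n choose i) * k ^ i * (n - k) ^ (n - i)" for i
  have rec: "t (Suc i) * (Suc i * (n - k)) = t i * ((n - i) * k)" if "i < n" for i
  proof -
    have "(n - k) ^ (n - i) = (n - k) * (n - k) ^ (n - Suc i)"
      using that by (metis Suc_diff_Suc power_Suc)
    moreover have "(n choose Suc i) * Suc i = (n choose i) * (n - i)"
      by (metis binomial_absorb_comp binomial_absorption mult.commute)
    ultimately show ?thesis unfolding t_def
      by (metis (no_types, lifting) mult.assoc mult.commute mult.left_commute power_Suc)
  qed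
  have up: "t i \<le> t k" if "i \<le> k" for i
    using that
  proof (induction i rule: inc_induct)
    case (step i)
    have "k < n \<or> k = n" using k by auto
    moreover have ?case if "k < n"
    proof -
      have "t i * (Suc i * (n - k)) \<le> t i * ((n - i) * k)"
        using step.hyps by (subst mult.commute[of "n - i"]) (intro mult_left_mono mult_mono, auto)
      also have "\<dots> = t (Suc i) * (Suc i * (n - k))" using rec[of i] step.hyps k by simp
      finally have "t i \<le> t (Suc i)" using that by simp
      with step.IH show ?thesis by simp
    qed
    \<comment> \<open>Here \<open>n - k = 0\<close>, so the recursion carries no information, but
      \<open>t i\<close> vanishes for \<open>i < n\<close>.\<close>
    moreover have ?case if "k = n"
      using that step.hyps by (simp add: t_def zero_power)
    ultimately show ?case by blast
  qed simp
  have down: "t i \<le> t k" if "k \<le> i" "i \<le> n" for i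
    using that
  proof (induction i rule: dec_induct)
    case (step i)
    have "t (Suc i) * (Suc i * (n - k)) = t i * ((n - i) * k)" using rec[of i] step.prems by simp
    also have "\<dots> \<le> t i * (Suc i * (n - k))"
      using step.hyps by (subst mult.commute[of "n - i"]) (intro mult_left_mono mult_mono, auto)
    finally have "t (Suc i) \<le> t i" using step.hyps step.prems by simp
    with step show ?case by simp
  qed simp
  have "n ^ n = (k + (n - k)) ^ n" using k by simp
  also have "\<dots> = (\<Sum>i\<le>n. t i)" unfolding t_def by (subst binomial) simp
  also have "\<dots> \<le> (\<Sum>i\<le>n. t k)"
    using up down by (intro sum_mono) (metis atMost_iff nat_le_linear)
  finally show ?thesis by (simp add: t_def)
qed

text \<open>\<open>power_self_le_binomial\<close> at \<open>y * k\<close>, with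
  \<open>k ^ (y * k)\<close> cancelled. Bounding \<open>y * k + 1\<close> by
  \<open>(y + 1) * k\<close> supplies the factor \<open>k\<close> of the binomial
  coefficient.\<close>

lemma binomial_multiple_lower:
  fixes y k :: nat
  assumes "y \<ge> 2" "k > 0"
  shows "y ^ (y * k) \<le> (y + 1) * (k * (y * k choose k)) * (y - 1) ^ ((y - 1) * k)"
proof -
  have nk: "y * k - k = (y - 1) * k" by (simp add: diff_mult_distrib)
  have e: "y * k = k + (y - 1) * k" using assms by (cases y) auto
  have "y ^ (y * k) * k ^ (y * k) \<le> (y * k + 1) * ((y * k choose k) * k ^ k * ((y - 1) * k) ^ ((y - 1) * k))"
    using power_self_le_binomial[of k "y * k"] assms unfolding nk by (simp add: power_mult_distrib)
  also have "\<dots> = ((y * k + 1) * ((y * k choose k) * (y - 1) ^ ((y - 1) * k))) * k ^ (y * k)"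
  proof -
    have "k ^ (y * k) = k ^ k * k ^ ((y - 1) * k)" by (metis e power_add)
    then show ?thesis by (simp only: power_mult_distrib ac_simps)
  qed
  finally have "y ^ (y * k) \<le> (y * k + 1) * ((y * k choose k) * (y - 1) ^ ((y - 1) * k))"
    using assms by simp
  also have "\<dots> \<le> ((y + 1) * k) * ((y * k choose k) * (y - 1) ^ ((y - 1) * k))"
    using assms by (intro mult_right_mono) (auto simp: distrib_right)
  finally show ?thesis by (simp only: ac_simps)
qed

text \<open>In the falling products \<open>(N - t) / N \<le> (n - t) / n\<close> holds factor by
  factor.\<close>

lemma binomial_scaled_lower:
  fixes N n k :: nat
  assumes "0 < k" "k \<le> N" "N \<le> n"
  shows "real (k * (N choose k)) * (real n / real N) ^ k \<le> real (k * (n choose k))"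
proof -
  have falling: "real (k * (m choose k)) * fact (k - 1) = (\<Prod>t<k. real m - real t)" if "k \<le> m" for m
  proof -
    have "real (k * (m choose k) * fact (k - 1)) = real (\<Prod>t<k. m - t)"
      using prod_falling_eq[OF assms(1) that] by (simp only:)
    also have "\<dots> = (\<Prod>t<k. real m - real t)"
      unfolding of_nat_prod using that by (intro prod.cong) (auto simp: of_nat_diff)
    finally show ?thesis by simp
  qed
  have "real (k * (N choose k)) * (real n / real N) ^ k * fact (k - 1) =
      (\<Prod>t<k. real N - real t) * (\<Prod>t<k. real n / real N)"
    using falling[OF assms(2)] by (simp add: mult.commute mult.left_commute)
  also have "\<dots> = (\<Prod>t<k. (real N - real t) * (real n / real N))"
    by (rule prod.distrib[symmetric])
  also have "\<dots> \<le> (\<Prod>t<k. real n - real t)"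
  proof (rule prod_mono)
    fix t assume t: "t \<in> {..<k}"
    then have "real t * real N \<le> real t * real n" "real t \<le> real N" using assms by (auto intro: mult_left_mono)
    then have "(real N - real t) * (real n / real N) \<le> real n - real t"
      using assms by (simp add: field_simps)
    then show "0 \<le> (real N - real t) * (real n / real N) \<and>
        (real N - real t) * (real n / real N) \<le> real n - real t"
      using \<open>real t \<le> real N\<close> by simp
  qed
  also have "\<dots> = real (k * (n choose k)) * fact (k - 1)"
    using falling[of n] assms by simp
  finally show ?thesis by (rule mult_right_le_imp_le) simp
qed

section \<open>Criteria that refute \<open>no_large_power\<close>\<close>

lemma not_no_large_power_small:
  assumes "0 < k" "k \<le> N" "N \<le> n" "n < 8 * k" and "totient_psi k < ln (real (k * (N choose k)))"
  shows "\<not> no_large_power n k"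
proof
  assume "no_large_power n k"
  then have "ln (real (k * (n choose k))) \<le> totient_psi k"
    using assms by (intro ln_mult_binomial_le_small) auto
  moreover have "real (k * (N choose k)) \<le> real (k * (n choose k))"
    using assms by (intro of_nat_mono mult_left_mono binomial_right_mono) auto
  then have "ln (real (k * (N choose k))) \<le> ln (real (k * (n choose k)))"
    using assms by (intro ln_mono) auto
  ultimately show False using assms(5) by simp
qed

text \<open>Passing from \<open>y * k\<close> to \<open>n = z * y * k\<close> adds at least
  \<open>k * ln z\<close> to the lower bound and at most that to the upper bound, as fewer than
  \<open>k + 1\<close> primes lie below \<open>k\<close>. So the comparison at \<open>y * k\<close>
  settles all larger \<open>n\<close>.\<close>

lemma not_no_large_power_large:
  assumes k: "0 < k" and y: "2 \<le> y" "y * k \<le> n" and c: "card {p. prime p \<and> p < k} \<le> c"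
    and less: "totient_psi k + real c * ln (real y / 2) < ln (real (k * (y * k choose k)))"
  shows "\<not> no_large_power n k"
proof
  assume no: "no_large_power n k"
  define z where "z = real n / real (y * k)"
  let ?c = "card {p. prime p \<and> p < k}"
  have yk: "k \<le> y * k" "2 * k \<le> y * k" "0 < y * k" using k y by auto
  have z1: "1 \<le> z" using k y by (simp add: z_def flip: of_nat_mult)
  have "ln (real n / (2 * real k)) = ln (z * (real y / 2))"
    using k y by (simp add: z_def mult.commute)
  also have "\<dots> = ln z + ln (real y / 2)" using z1 y by (intro ln_mult_pos) auto
  finally have eq: "ln (real n / (2 * real k)) = ln z + ln (real y / 2)" .
  have "?c \<le> card {..<k}" by (intro card_mono) auto
  then have "real ?c * ln z \<le> real k * ln z" using z1 by (intro mult_right_mono) auto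
  moreover have "real ?c * ln (real y / 2) \<le> real c * ln (real y / 2)"
    using c y by (intro mult_right_mono) auto
  moreover have "ln (real (k * (n choose k))) \<le> totient_psi k + real ?c * (ln z + ln (real y / 2))"
    using ln_mult_binomial_le_large[OF k _ no] yk y eq by simp
  moreover have "ln (real (k * (y * k choose k))) + real k * ln z \<le> ln (real (k * (n choose k)))"
  proof -
    have pos: "0 < real (k * (y * k choose k))" using k yk by simp
    have "ln (real (k * (y * k choose k))) + real k * ln z = ln (real (k * (y * k choose k)) * z ^ k)"
      using z1 ln_mult_pos[OF pos, of "z ^ k"] by (simp add: ln_realpow)
    also have "\<dots> \<le> ln (real (k * (n choose k)))"
      using binomial_scaled_lower[OF k yk(1) y(2)] pos z1 unfolding z_def[symmetric]
      by (intro ln_mono) (auto intro!: mult_pos_pos)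
    finally show ?thesis .
  qed
  ultimately show False using less by (simp add: distrib_left)
qed

text \<open>Applied with \<open>(y, r) = (5, 12), (8, 20), (20, 53)\<close>; then \<open>r\<close> is \<open>y ^ y / (y - 1) ^ (y - 1)\<close> rounded
  down.\<close>

lemma power_le_mult_binomial:
  fixes r y k :: nat
  assumes "2 \<le> y" "0 < k" "r * (y - 1) ^ (y - 1) \<le> y ^ y"
  shows "r ^ k \<le> (y + 1) * (k * (y * k choose k))"
proof -
  have "r ^ k * (y - 1) ^ ((y - 1) * k) = (r * (y - 1) ^ (y - 1)) ^ k"
    by (simp add: power_mult_distrib power_mult)
  also have "\<dots> \<le> (y ^ y) ^ k" by (rule power_mono[OF assms(3)]) simp
  also have "\<dots> = y ^ (y * k)" by (simp add: power_mult)
  also have "\<dots> \<le> (y + 1) * (k * (y * k choose k)) * (y - 1) ^ ((y - 1) * k)"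
    by (rule binomial_multiple_lower[OF assms(1,2)])
  finally show ?thesis using assms(1) by simp
qed

lemma totient_psi_mono: "k \<le> k' \<Longrightarrow> totient_psi k \<le> totient_psi k'"
  unfolding totient_psi_def
  by (intro sum_mono2) (auto intro: mangoldt_nonneg finite_subset[of _ "{..<4 * k'}"])

text \<open>The list is a certificate: \<open>exps\<close> says that \<open>p ^ (e + 1)\<close> has
  totient at least \<open>2 * k\<close>, so every prime power of smaller totient divides
  \<open>M\<close>.\<close>

lemma totient_psi_le_ln:
  fixes xs :: "(nat \<times> nat) list"
  assumes cover: "\<And>q. prime q \<Longrightarrow> q \<le> 2 * k \<Longrightarrow> q \<in> fst ` set xs"
    and exps: "\<forall>(p, e)\<in>set xs. 2 * k \<le> p ^ e * (p - 1)"
    and M: "(\<Prod>(p, e)\<leftarrow>xs. p ^ e) = M" "0 < M"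
  shows "totient_psi k \<le> ln (real M)"
proof -
  have dvd: "d dvd M" if d: "primepow d" "totient d < 2 * k" for d
  proof -
    obtain p j where pj: "prime p" "d = p ^ Suc j" using d(1) by (rule primepow_Suc_E)
    have p2: "2 \<le> p" using pj(1) by (rule prime_ge_2_nat)
    have tot: "p ^ j * (p - 1) < 2 * k" using d(2) unfolding pj(2) totient_prime_power_Suc[OF pj(1)] .
    have "1 * (p - 1) \<le> p ^ j * (p - 1)" using p2 by (intro mult_right_mono) auto
    then have "p \<le> 2 * k" using tot by linarith
    then obtain e where e: "(p, e) \<in> set xs" using cover[OF pj(1)] by auto
    then have "2 * k \<le> p ^ e * (p - 1)" using bspec[OF exps] by fastforce
    with tot have "p ^ j * (p - 1) < p ^ e * (p - 1)" by (rule less_le_trans)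
    then have "p ^ j < p ^ e" by simp
    then have "Suc j \<le> e" using p2 by (simp add: power_strict_increasing_iff Suc_le_eq)
    then have "d dvd p ^ e" unfolding pj(2) by (rule le_imp_power_dvd)
    moreover have "p ^ e \<in> set (map (\<lambda>(p, e). p ^ e) xs)" using e by force
    then have "p ^ e dvd M" unfolding M(1)[symmetric] by (rule prod_list_dvd)
    ultimately show ?thesis by (rule dvd_trans)
  qed
  have "totient_psi k = (\<Sum>d | d < 4 * k \<and> totient d < 2 * k \<and> primepow d. mangoldt d)"
    unfolding totient_psi_def by (intro sum.mono_neutral_right) (auto simp: mangoldt_def intro: finite_subset[of _ "{..<4 * k}"])
  also have "\<dots> \<le> (\<Sum>d | d dvd M. mangoldt d)"
    using dvd M by (intro sum_mono2) (auto intro: mangoldt_nonneg)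
  also have "\<dots> = ln (real M)" using mangoldt_sum[of M, where ?'a = real] M by simp
  finally show ?thesis .
qed

text \<open>Multiplying by \<open>(k - 1)!\<close> turns the comparison into one between products of
  naturals, which can be evaluated. The factor \<open>a\<close> carries the contribution of the
  primes below \<open>k\<close>.\<close>

lemma totient_psi_less_ln_binomial:
  fixes a :: nat
  assumes "0 < k" "k \<le> N" "totient_psi k \<le> ln (real M)" "0 < M" "0 < a" "M * a * fact (k - 1) < (\<Prod>t<k. N - t)"
  shows "totient_psi k + ln (real a) < ln (real (k * (N choose k)))"
proof -
  have "M * a < k * (N choose k)"
    using assms(6) unfolding prod_falling_eq[OF assms(1,2)] by simp
  then have "real (M * a) < real (k * (N choose k))" by (rule of_nat_less_iff[THEN iffD2])
  then have "ln (real M * real a) < ln (real (k * (N choose k)))"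
    using assms by (intro ln_strict_mono) auto
  then show ?thesis using assms(3-5) by (simp add: ln_mult_pos)
qed

section \<open>Numerical checks\<close>

lemma prime_mem_of_sieve:
  fixes q b :: nat
  assumes sieve: "\<forall>q\<in>set [2..<b]. (\<exists>r\<in>set rs. r dvd q) \<or> q \<in> set qs"
    and rs: "\<forall>r\<in>set rs. prime r \<and> r \<in> set qs" and q: "prime q" "q < b"
  shows "q \<in> set qs"
proof -
  have "q \<in> set [2..<b]" using q prime_ge_2_nat[of q] by simp
  with sieve consider r where "r \<in> set rs" "r dvd q" | "q \<in> set qs" by blast
  then show ?thesis
  proof cases
    case 1
    with rs q(1) have "r = q" using primes_dvd_imp_eq by blast
    with 1 rs show ?thesis by blast
  qed
qed

text \<open>Sieving by the primes up to 13 suffices because \<open>17 ^ 2 = 289\<close>. The bound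
  serves the certificates up to \<open>2 * k = 270\<close>.\<close>

lemma prime_less_271:
  fixes q :: nat
  assumes "prime q" "q < 271"
  shows "q \<in> set
    [2, 3, 5, 7, 11, 13, 17, 19, 23, 29, 31, 37, 41, 43, 47, 53, 59, 61, 67, 71, 73, 79, 83,
     89, 97, 101, 103, 107, 109, 113, 127, 131, 137, 139, 149, 151, 157, 163, 167, 173, 179,
     181, 191, 193, 197, 199, 211, 223, 227, 229, 233, 239, 241, 251, 257, 263, 269]"
proof (rule prime_mem_of_sieve[where rs = "[2, 3, 5, 7, 11, 13]", OF _ _ assms])
qed simp_all

text \<open>The list holds all primes below 148, so both factors in a proper factorization would be
  at least 148.\<close>

lemma prime_by_trial_division:
  fixes p :: nat
  assumes "1 < p" "p < 148\<^sup>2"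
    and ndvd: "\<forall>q\<in>set
    [2, 3, 5, 7, 11, 13, 17, 19, 23, 29, 31, 37, 41, 43, 47, 53, 59, 61, 67, 71, 73, 79, 83,
     89, 97, 101, 103, 107, 109, 113, 127, 131, 137, 139].
      \<not> q dvd p"
  shows "prime p"
  unfolding prime_nat_iff
proof (intro conjI allI impI)
  fix d assume "d dvd p"
  then obtain c where c: "p = d * c" by auto
  have large: "148 \<le> x" if x: "x dvd p" "x \<noteq> 1" for x
  proof (rule ccontr)
    assume "\<not> 148 \<le> x"
    obtain q where q: "prime q" "q dvd x" using prime_factor_nat[OF x(2)] by blast
    have "x > 0" using x(1) assms(1) by (auto intro: dvd_pos_nat[of p])
    then have "q < 148" using dvd_imp_le[OF q(2)] \<open>\<not> 148 \<le> x\<close> by simp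
    have "\<not> q dvd p"
      by (rule bspec[OF ndvd]) (use prime_less_271[OF q(1)] \<open>q < 148\<close> in auto)
    with q(2) x(1) show False using dvd_trans by blast
  qed
  have "\<not> (148 \<le> d \<and> 148 \<le> c)"
    using mult_le_mono[of 148 d 148 c] assms(2) c by auto
  then have "d = 1 \<or> c = 1" using large[of d] large[of c] c by auto
  then show "d = 1 \<or> d = p" using c by auto
qed (rule assms(1))

text \<open>The prime \<open>p\<close> serves every \<open>n\<close> from \<open>p\<close> to
  \<open>q - 1\<close>, with the worst case \<open>q - 1\<close> tested. For the gap
  \<open>d = n - p\<close> the conditions read \<open>5 * d \<le> n\<close>, and
  \<open>d \<le> 13\<close> or \<open>20 * d \<le> n\<close>. The last entry only bounds the
  range.\<close>

fun prime_chain :: "nat \<Rightarrow> nat list \<Rightarrow> bool" where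
  "prime_chain p [] \<longleftrightarrow> True"
| "prime_chain p (q # qs) \<longleftrightarrow> prime p \<and> 4 * (q - 1) \<le> 5 * p \<and> (q - 1 - p \<le> 13 \<or> 19 * (q - 1) \<le> 20 * p) \<and>
     prime_chain q qs"

lemma prime_chain_cover:
  assumes "prime_chain p qs" "p \<le> n" "n < last (p # qs)"
  shows "\<exists>P. prime P \<and> P \<le> n \<and> 4 * n \<le> 5 * P \<and> (n - P \<le> 13 \<or> 19 * n \<le> 20 * P)"
  using assms
proof (induction p qs rule: prime_chain.induct)
  case (2 p q qs)
  show ?case
  proof (cases "q \<le> n")
    case True
    with 2 show ?thesis by auto
  next
    case False
    then have "n \<le> q - 1" by simp
    with 2(2,3) show ?thesis by (intro exI[of _ p]) auto
  qed
qed simp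

text \<open>Each entry is the largest prime that the condition in \<open>prime_chain\<close> allows.\<close>

lemma prime_chain_11_151:
  "prime_chain 11 [13, 17, 19, 23, 29, 37, 47, 59, 73, 83, 97, 109, 113, 127, 139, 151]"
  by simp

lemma prime_chain_151_20737:
  "prime_chain 151
    [163, 173, 181, 193, 199, 211, 223, 233, 241, 251, 263, 277, 283, 293, 307, 317, 331,
     349, 367, 383, 401, 421, 443, 467, 491, 509, 523, 547, 571, 601, 631, 661, 691, 727,
     761, 797, 839, 883, 929, 977, 1021, 1069, 1123, 1181, 1237, 1303, 1367, 1439, 1511,
     1583, 1667, 1753, 1831, 1913, 2011, 2113, 2221, 2333, 2447, 2557, 2689, 2819, 2963,
     3119, 3271, 3433, 3613, 3803, 4003, 4211, 4423, 4651, 4889, 5147, 5417, 5701, 5987,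
     6301, 6619, 6967, 7333, 7717, 8123, 8543, 8971, 9439, 9931, 10453, 11003, 11579, 12163,
     12799, 13469, 14177, 14923, 15683, 16493, 17359, 18269, 19231, 20233, 21283]"
  by (simp add: prime_by_trial_division del: prime_nat_numeral_eq)

text \<open>In each list, \<open>p ^ e\<close> is the largest power of \<open>p\<close> with totient less than \<open>2 * k\<close>.\<close>

lemma totient_psi_1: "totient_psi 1 \<le> ln (real 2)"
proof (rule totient_psi_le_ln)
  show "q \<in> fst ` set
    [(2, 1)]"
    if "prime q" "q \<le> 2 * 1" for q :: nat
    using prime_less_271[OF that(1)] that(2) by auto
qed simp_all

lemma totient_psi_2: "totient_psi 2 \<le> ln (real 12)"
proof (rule totient_psi_le_ln)
  show "q \<in> fst ` set
    [(2, 2), (3, 1)]"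
    if "prime q" "q \<le> 2 * 2" for q :: nat
    using prime_less_271[OF that(1)] that(2) by auto
qed simp_all

lemma totient_psi_3: "totient_psi 3 \<le> ln (real 120)"
proof (rule totient_psi_le_ln)
  show "q \<in> fst ` set
    [(2, 3), (3, 1), (5, 1)]"
    if "prime q" "q \<le> 2 * 3" for q :: nat
    using prime_less_271[OF that(1)] that(2) by auto
qed simp_all

lemma totient_psi_4: "totient_psi 4 \<le> ln (real 2520)"
proof (rule totient_psi_le_ln)
  show "q \<in> fst ` set
    [(2, 3), (3, 2), (5, 1), (7, 1)]"
    if "prime q" "q \<le> 2 * 4" for q :: nat
    using prime_less_271[OF that(1)] that(2) by auto
qed simp_all

lemma totient_psi_5: "totient_psi 5 \<le> ln (real 5040)"
proof (rule totient_psi_le_ln)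
  show "q \<in> fst ` set
    [(2, 4), (3, 2), (5, 1), (7, 1)]"
    if "prime q" "q \<le> 2 * 5" for q :: nat
    using prime_less_271[OF that(1)] that(2) by auto
qed simp_all

lemma totient_psi_6: "totient_psi 6 \<le> ln (real 55440)"
proof (rule totient_psi_le_ln)
  show "q \<in> fst ` set
    [(2, 4), (3, 2), (5, 1), (7, 1), (11, 1)]"
    if "prime q" "q \<le> 2 * 6" for q :: nat
    using prime_less_271[OF that(1)] that(2) by auto
qed simp_all

lemma totient_psi_7: "totient_psi 7 \<le> ln (real 720720)"
proof (rule totient_psi_le_ln)
  show "q \<in> fst ` set
    [(2, 4), (3, 2), (5, 1), (7, 1), (11, 1), (13, 1)]"
    if "prime q" "q \<le> 2 * 7" for q :: nat
    using prime_less_271[OF that(1)] that(2) by auto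
qed simp_all

lemma totient_psi_8: "totient_psi 8 \<le> ln (real 720720)"
proof (rule totient_psi_le_ln)
  show "q \<in> fst ` set
    [(2, 4), (3, 2), (5, 1), (7, 1), (11, 1), (13, 1)]"
    if "prime q" "q \<le> 2 * 8" for q :: nat
    using prime_less_271[OF that(1)] that(2) by auto
qed simp_all

lemma totient_psi_9: "totient_psi 9 \<le> ln (real 24504480)"
proof (rule totient_psi_le_ln)
  show "q \<in> fst ` set
    [(2, 5), (3, 2), (5, 1), (7, 1), (11, 1), (13, 1), (17, 1)]"
    if "prime q" "q \<le> 2 * 9" for q :: nat
    using prime_less_271[OF that(1)] that(2) by auto
qed simp_all

lemma totient_psi_10: "totient_psi 10 \<le> ln (real 1396755360)"
proof (rule totient_psi_le_ln)
  show "q \<in> fst ` set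
    [(2, 5), (3, 3), (5, 1), (7, 1), (11, 1), (13, 1), (17, 1), (19, 1)]"
    if "prime q" "q \<le> 2 * 10" for q :: nat
    using prime_less_271[OF that(1)] that(2) by auto
qed simp_all

lemma totient_psi_11: "totient_psi 11 \<le> ln (real 6983776800)"
proof (rule totient_psi_le_ln)
  show "q \<in> fst ` set
    [(2, 5), (3, 3), (5, 2), (7, 1), (11, 1), (13, 1), (17, 1), (19, 1)]"
    if "prime q" "q \<le> 2 * 11" for q :: nat
    using prime_less_271[OF that(1)] that(2) by auto
qed simp_all

lemma totient_psi_12: "totient_psi 12 \<le> ln (real 160626866400)"
proof (rule totient_psi_le_ln)
  show "q \<in> fst ` set
    [(2, 5), (3, 3), (5, 2), (7, 1), (11, 1), (13, 1), (17, 1), (19, 1), (23, 1)]"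
    if "prime q" "q \<le> 2 * 12" for q :: nat
    using prime_less_271[OF that(1)] that(2) by auto
qed simp_all

lemma totient_psi_13: "totient_psi 13 \<le> ln (real 160626866400)"
proof (rule totient_psi_le_ln)
  show "q \<in> fst ` set
    [(2, 5), (3, 3), (5, 2), (7, 1), (11, 1), (13, 1), (17, 1), (19, 1), (23, 1)]"
    if "prime q" "q \<le> 2 * 13" for q :: nat
    using prime_less_271[OF that(1)] that(2) by auto
qed simp_all

text \<open>From here on \<open>k\<close> runs through the right ends of the ranges in
  \<open>not_no_large_power_ge_14\<close>.\<close>

lemma totient_psi_18: "totient_psi 18 \<le> ln (real 288807105787200)"
proof (rule totient_psi_le_ln)
  show "q \<in> fst ` set
    [(2, 6), (3, 3), (5, 2), (7, 1), (11, 1), (13, 1), (17, 1), (19, 1), (23, 1), (29, 1),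
     (31, 1)]"
    if "prime q" "q \<le> 2 * 18" for q :: nat
    using prime_less_271[OF that(1)] that(2) by auto
qed simp_all

lemma totient_psi_24: "totient_psi 24 \<le> ln (real 6198089008491993412800)"
proof (rule totient_psi_le_ln)
  show "q \<in> fst ` set
    [(2, 6), (3, 3), (5, 2), (7, 2), (11, 1), (13, 1), (17, 1), (19, 1), (23, 1), (29, 1),
     (31, 1), (37, 1), (41, 1), (43, 1), (47, 1)]"
    if "prime q" "q \<le> 2 * 24" for q :: nat
    using prime_less_271[OF that(1)] that(2) by auto
qed simp_all

lemma totient_psi_33: "totient_psi 33 \<le> ln (real 7093601304616933605068169600)"
proof (rule totient_psi_le_ln)
  show "q \<in> fst ` set
    [(2, 7), (3, 4), (5, 2), (7, 2), (11, 1), (13, 1), (17, 1), (19, 1), (23, 1), (29, 1),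
     (31, 1), (37, 1), (41, 1), (43, 1), (47, 1), (53, 1), (59, 1), (61, 1)]"
    if "prime q" "q \<le> 2 * 33" for q :: nat
    using prime_less_271[OF that(1)] that(2) by auto
qed simp_all

lemma totient_psi_48: "totient_psi 48 \<le> ln (real 1437533509890978910608944514130150588800)"
proof (rule totient_psi_le_ln)
  show "q \<in> fst ` set
    [(2, 7), (3, 4), (5, 2), (7, 2), (11, 1), (13, 1), (17, 1), (19, 1), (23, 1), (29, 1),
     (31, 1), (37, 1), (41, 1), (43, 1), (47, 1), (53, 1), (59, 1), (61, 1), (67, 1), (71,
     1), (73, 1), (79, 1), (83, 1), (89, 1)]"
    if "prime q" "q \<le> 2 * 48" for q :: nat
    using prime_less_271[OF that(1)] that(2) by auto
qed simp_all

lemma totient_psi_68: "totient_psi 68 \<le> ln (real 3498684095841321833803782291563341974145184644268856864000)"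
proof (rule totient_psi_le_ln)
  show "q \<in> fst ` set
    [(2, 8), (3, 4), (5, 3), (7, 2), (11, 2), (13, 1), (17, 1), (19, 1), (23, 1), (29, 1),
     (31, 1), (37, 1), (41, 1), (43, 1), (47, 1), (53, 1), (59, 1), (61, 1), (67, 1), (71,
     1), (73, 1), (79, 1), (83, 1), (89, 1), (97, 1), (101, 1), (103, 1), (107, 1), (109, 1),
     (113, 1), (127, 1), (131, 1)]"
    if "prime q" "q \<le> 2 * 68" for q :: nat
    using prime_less_271[OF that(1)] that(2) by auto
qed simp_all

lemma totient_psi_96: "totient_psi 96 \<le> ln (real 267474709889570097117289268568593003759806144780733234750735097795519258580065888000)"
proof (rule totient_psi_le_ln)
  show "q \<in> fst ` set
    [(2, 8), (3, 5), (5, 3), (7, 2), (11, 2), (13, 2), (17, 1), (19, 1), (23, 1), (29, 1),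
     (31, 1), (37, 1), (41, 1), (43, 1), (47, 1), (53, 1), (59, 1), (61, 1), (67, 1), (71,
     1), (73, 1), (79, 1), (83, 1), (89, 1), (97, 1), (101, 1), (103, 1), (107, 1), (109, 1),
     (113, 1), (127, 1), (131, 1), (137, 1), (139, 1), (149, 1), (151, 1), (157, 1), (163,
     1), (167, 1), (173, 1), (179, 1), (181, 1), (191, 1)]"
    if "prime q" "q \<le> 2 * 96" for q :: nat
    using prime_less_271[OF that(1)] that(2) by auto
qed simp_all

lemma totient_psi_135: "totient_psi 135 \<le> ln (real 606350483373346533286815984571228902269045369088361205666402419910065128632965928601199276507991733496950211960128000)"
proof (rule totient_psi_le_ln)
  show "q \<in> fst ` set
    [(2, 9), (3, 5), (5, 3), (7, 2), (11, 2), (13, 2), (17, 1), (19, 1), (23, 1), (29, 1),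
     (31, 1), (37, 1), (41, 1), (43, 1), (47, 1), (53, 1), (59, 1), (61, 1), (67, 1), (71,
     1), (73, 1), (79, 1), (83, 1), (89, 1), (97, 1), (101, 1), (103, 1), (107, 1), (109, 1),
     (113, 1), (127, 1), (131, 1), (137, 1), (139, 1), (149, 1), (151, 1), (157, 1), (163,
     1), (167, 1), (173, 1), (179, 1), (181, 1), (191, 1), (193, 1), (197, 1), (199, 1),
     (211, 1), (223, 1), (227, 1), (229, 1), (233, 1), (239, 1), (241, 1), (251, 1), (257,
     1), (263, 1), (269, 1)]"
    if "prime q" "q \<le> 2 * 135" for q :: nat
    using prime_less_271[OF that(1)] that(2) by auto
qed simp_all

section \<open>Existence of large prime powers\<close>

text \<open>For \<open>n < 8 * k\<close> the check at \<open>5 * k\<close> is enough. Beyond, the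
  check at \<open>8 * k\<close> carries the term \<open>c * ln (8 / 2)\<close>, hence the factor
  \<open>4 ^ c\<close>.\<close>

lemma not_no_large_power_of_totient_psi_bound:
  assumes k: "0 < k" and M: "totient_psi k \<le> ln (real M)" "0 < M" and c: "card {p. prime p \<and> p < k} \<le> c"
    and five: "M * 1 * fact (k - 1) < (\<Prod>t<k. 5 * k - t)"
    and eight: "M * 4 ^ c * fact (k - 1) < (\<Prod>t<k. 8 * k - t)" and n: "5 * k \<le> n"
  shows "\<not> no_large_power n k"
proof (cases "n < 8 * k")
  case True
  have "totient_psi k + ln (real 1) < ln (real (k * (5 * k choose k)))"
    by (rule totient_psi_less_ln_binomial[OF k _ M _ five]) auto
  then show ?thesis
    using k n True by (intro not_no_large_power_small[where N = "5 * k"]) auto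
next
  case False
  have "totient_psi k + ln (real (4 ^ c)) < ln (real (k * (8 * k choose k)))"
    by (rule totient_psi_less_ln_binomial[OF k _ M _ eight]) auto
  then show ?thesis
    using k c False by (intro not_no_large_power_large[where y = 8 and c = c]) (auto simp: ln_realpow)
qed

lemma card_primes_below_le:
  assumes "k + 3 \<le> 3 * c"
  shows "card {p. prime p \<and> p < (k::nat)} \<le> c"
  using card_primes_below[of k] assms by linarith

lemma not_no_large_power_le_13:
  assumes "0 < k" "k \<le> 13" and n: "5 * k \<le> n"
  shows "\<not> no_large_power n k"
proof -
  \<comment> \<open>For \<open>k = 1\<close> and \<open>k = 4\<close> the bound of
    \<open>card_primes_below\<close> gives 2 and 3, too large for the check at \<open>8 * k\<close>;
    the exact counts are used.\<close>
  have c1: "card {p. prime p \<and> p < (1::nat)} \<le> 0"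
  proof -
    have "{p. prime p \<and> p < (1::nat)} = {}" by auto
    then show ?thesis by (simp only: card.empty)
  qed
  have c4: "card {p. prime p \<and> p < (4::nat)} \<le> 2"
  proof -
    have "{p. prime p \<and> p < (4::nat)} \<subseteq> {2, 3}"
    proof
      fix p :: nat assume "p \<in> {p. prime p \<and> p < 4}"
      then have "2 \<le> p" "p < 4" using prime_ge_2_nat by auto
      then show "p \<in> {2, 3}" by auto
    qed
    then have "card {p. prime p \<and> p < (4::nat)} \<le> card {2, 3::nat}" by (intro card_mono) auto
    then show ?thesis by simp
  qed
  note bound = not_no_large_power_of_totient_psi_bound
  consider "k = 1" | "k = 2" | "k = 3" | "k = 4" | "k = 5" | "k = 6" | "k = 7" | "k = 8" | "k = 9"
    | "k = 10" | "k = 11" | "k = 12" | "k = 13"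
    using assms(1,2) by (auto simp: le_Suc_eq numeral_eq_Suc)
  then show ?thesis
  proof cases
    case 1
    have "\<not> no_large_power n 1"
      by (rule bound[OF _ totient_psi_1 _ c1]) (use n 1 in \<open>simp_all add: fact_numeral lessThan_nat_numeral\<close>)
    with 1 show ?thesis by simp
  next
    case 2
    have "\<not> no_large_power n 2"
      by (rule bound[OF _ totient_psi_2 _ card_primes_below_le[of 2 2]]) (use n 2 in \<open>simp_all add: fact_numeral lessThan_nat_numeral\<close>)
    with 2 show ?thesis by simp
  next
    case 3
    have "\<not> no_large_power n 3"
      by (rule bound[OF _ totient_psi_3 _ card_primes_below_le[of 3 2]]) (use n 3 in \<open>simp_all add: fact_numeral lessThan_nat_numeral\<close>)
    with 3 show ?thesis by simp
  next
    case 4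
    have "\<not> no_large_power n 4"
      by (rule bound[OF _ totient_psi_4 _ c4]) (use n 4 in \<open>simp_all add: fact_numeral lessThan_nat_numeral\<close>)
    with 4 show ?thesis by simp
  next
    case 5
    have "\<not> no_large_power n 5"
      by (rule bound[OF _ totient_psi_5 _ card_primes_below_le[of 5 3]]) (use n 5 in \<open>simp_all add: fact_numeral lessThan_nat_numeral\<close>)
    with 5 show ?thesis by simp
  next
    case 6
    have "\<not> no_large_power n 6"
      by (rule bound[OF _ totient_psi_6 _ card_primes_below_le[of 6 3]]) (use n 6 in \<open>simp_all add: fact_numeral lessThan_nat_numeral\<close>)
    with 6 show ?thesis by simp
  next
    case 7
    have "\<not> no_large_power n 7"
      by (rule bound[OF _ totient_psi_7 _ card_primes_below_le[of 7 4]]) (use n 7 in \<open>simp_all add: fact_numeral lessThan_nat_numeral\<close>)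
    with 7 show ?thesis by simp
  next
    case 8
    have "\<not> no_large_power n 8"
      by (rule bound[OF _ totient_psi_8 _ card_primes_below_le[of 8 4]]) (use n 8 in \<open>simp_all add: fact_numeral lessThan_nat_numeral\<close>)
    with 8 show ?thesis by simp
  next
    case 9
    have "\<not> no_large_power n 9"
      by (rule bound[OF _ totient_psi_9 _ card_primes_below_le[of 9 4]]) (use n 9 in \<open>simp_all add: fact_numeral lessThan_nat_numeral\<close>)
    with 9 show ?thesis by simp
  next
    case 10
    have "\<not> no_large_power n 10"
      by (rule bound[OF _ totient_psi_10 _ card_primes_below_le[of 10 5]]) (use n 10 in \<open>simp_all add: fact_numeral lessThan_nat_numeral\<close>)
    with 10 show ?thesis by simp
  next
    case 11
    have "\<not> no_large_power n 11"
      by (rule bound[OF _ totient_psi_11 _ card_primes_below_le[of 11 5]]) (use n 11 in \<open>simp_all add: fact_numeral lessThan_nat_numeral\<close>)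
    with 11 show ?thesis by simp
  next
    case 12
    have "\<not> no_large_power n 12"
      by (rule bound[OF _ totient_psi_12 _ card_primes_below_le[of 12 5]]) (use n 12 in \<open>simp_all add: fact_numeral lessThan_nat_numeral\<close>)
    with 12 show ?thesis by simp
  next
    case 13
    have "\<not> no_large_power n 13"
      by (rule bound[OF _ totient_psi_13 _ card_primes_below_le[of 13 6]]) (use n 13 in \<open>simp_all add: fact_numeral lessThan_nat_numeral\<close>)
    with 13 show ?thesis by simp
  qed
qed

text \<open>One inequality settles a whole range: the upper bound is taken at \<open>K\<close>, the
  lower bound \<open>53 ^ k\<close> at \<open>a\<close>. With \<open>y = 20\<close> the numbers 21
  and 10 are \<open>y + 1\<close> and \<open>y / 2\<close>.\<close>

lemma not_no_large_power_checkpoint: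
  assumes k: "0 < a" "a \<le> k" "k \<le> K" and M: "totient_psi K \<le> ln (real M)" "0 < M"
    and less: "21 * M * 10 ^ ((K + 5) div 3) < 53 ^ a" and n: "20 * k \<le> n"
  shows "\<not> no_large_power n k"
proof -
  define c where "c = (K + 5) div 3"
  have "53 ^ a \<le> (53 ^ k :: nat)" using k by (intro power_increasing) auto
  also have "\<dots> \<le> 21 * (k * (20 * k choose k))"
    using power_le_mult_binomial[of 20 k 53] k by simp
  finally have "M * 10 ^ c < k * (20 * k choose k)" using less unfolding c_def by linarith
  then have "real (M * 10 ^ c) < real (k * (20 * k choose k))" by (rule of_nat_less_iff[THEN iffD2])
  then have "ln (real M * 10 ^ c) < ln (real (k * (20 * k choose k)))"
    using M by (intro ln_strict_mono) auto
  moreover have "ln (real M * 10 ^ c) = ln (real M) + real c * ln 10"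
    using M by (simp add: ln_mult_pos ln_realpow)
  moreover have "totient_psi k \<le> ln (real M)" using totient_psi_mono[OF k(3)] M by simp
  moreover have "card {p. prime p \<and> p < k} \<le> c"
    using k by (intro card_primes_below_le) (simp add: c_def)
  ultimately show ?thesis
    using k n by (intro not_no_large_power_large[where y = 20 and c = c]) auto
qed

lemma real_card_primes_below: "real (card {p. prime p \<and> p < (k::nat)}) \<le> (real k + 5) / 3"
proof -
  have "real (3 * card {p. prime p \<and> p < k}) \<le> real (k + 5)"
    by (rule of_nat_mono[OF card_primes_below])
  then show ?thesis by simp
qed

lemma ln_mult_binomial_lower:
  fixes r y k :: nat
  assumes "2 \<le> y" "0 < k" "0 < r" "r * (y - 1) ^ (y - 1) \<le> y ^ y"
  shows "real k * ln (real r) - ln (real (y + 1)) \<le> ln (real (k * (y * k choose k)))"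
proof -
  have pos: "0 < real (k * (y * k choose k))" using assms(1,2) by simp
  have "real (r ^ k) \<le> real ((y + 1) * (k * (y * k choose k)))"
    by (rule of_nat_mono[OF power_le_mult_binomial[OF assms(1,2,4)]])
  then have "ln (real r ^ k) \<le> ln (real (y + 1) * real (k * (y * k choose k)))"
    using assms(3) by (intro ln_mono) (simp_all only: of_nat_power of_nat_mult, auto)
  also have "\<dots> = ln (real (y + 1)) + ln (real (k * (y * k choose k)))"
    using pos by (intro ln_mult_pos) auto
  finally show ?thesis using assms(3) by (simp add: ln_realpow)
qed

lemma ln_10_bounds: "ln (10::real) < 2.3028"
proof -
  have "ln (10::real) = ln 2 + ln 5" using ln_mult_pos[of "2::real" 5] by simp
  then show ?thesis using ln_2_bounds ln_5_bounds by simp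
qed

text \<open>The lower bound grows like \<open>3.91 * k\<close>, the upper one like
  \<open>(2.4 + 0.77) * k\<close>. From 136 on, where the table of certificates ends, the difference
  exceeds the constants.\<close>

lemma not_no_large_power_20:
  assumes k: "k \<ge> 136" and n: "20 * k \<le> n"
  shows "\<not> no_large_power n k"
proof (rule not_no_large_power_large[OF _ _ n order_refl])
  define c where "c = card {p. prime p \<and> p < k}"
  have "ln (50::real) = ln 10 + ln 5" using ln_mult_pos[of "10::real" 5] by simp
  moreover have "ln (10::real) = ln 2 + ln 5" using ln_mult_pos[of "2::real" 5] by simp
  moreover have "ln (50::real) \<le> ln 53" by simp
  ultimately have ln53: "39117/10000 \<le> ln (53::real)" using ln_2_bounds ln_5_bounds by simp
  have "ln (21::real) \<le> ln (5 ^ 2)" by simp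
  also have "\<dots> = 2 * ln 5" using ln_realpow[of 5 2] by simp
  finally have ln21: "ln (21::real) \<le> 32192/10000" using ln_5_bounds by simp
  have "real c * ln 10 \<le> (real k + 5) / 3 * (23028/10000)"
    using real_card_primes_below[of k] ln_10_bounds unfolding c_def by (intro mult_mono) auto
  then have "real c * ln 10 \<le> 7676/10000 * real k + 38380/10000" by (simp add: field_simps)
  moreover have "39117/10000 * real k \<le> real k * ln 53"
    using ln53 by (subst mult.commute, intro mult_left_mono) auto
  moreover have "real k * ln 53 - ln 21 \<le> ln (real (k * (20 * k choose k)))"
    using ln_mult_binomial_lower[of 20 k 53] k by simp
  moreover have "totient_psi k \<le> 12/5 * k + 80" using k by (intro totient_psi_le_linear) simp
  moreover have "136 \<le> real k" using k by simp
  ultimately have "totient_psi k + real c * ln 10 < ln (real (k * (20 * k choose k)))"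
    using ln21 by linarith
  then show "totient_psi k + real (card {p. prime p \<and> p < k}) * ln (real 20 / 2) < ln (real (k * (20 * k choose k)))"
    by (simp add: c_def)
qed (use k in auto)

text \<open>1037 is the least \<open>k\<close> with \<open>20 * k > 20736\<close>. A large
  \<open>k\<close> is essential: for \<open>n < 8 * k\<close> the slope 2.4847 barely exceeds
  2.4.\<close>

lemma not_no_large_power_5:
  assumes k: "k \<ge> 1037" and n: "5 * k \<le> n"
  shows "\<not> no_large_power n k"
proof (cases "n < 8 * k")
  case True
  have "ln (12::real) = 2 * ln 2 + ln 3" using ln_mult_pos[of "4::real" 3] by (simp add: ln_4)
  then have "24847/10000 * real k \<le> real k * ln 12"
    using ln_2_bounds ln_3_bounds by (subst mult.commute, intro mult_left_mono) auto
  moreover have "ln (6::real) = ln 2 + ln 3" using ln_mult_pos[of "2::real" 3] by simp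
  then have ln6: "ln (6::real) \<le> 2" using ln_2_bounds ln_3_bounds by simp
  moreover have "real k * ln 12 - ln 6 \<le> ln (real (k * (5 * k choose k)))"
    using ln_mult_binomial_lower[of 5 k 12] k by simp
  moreover have "totient_psi k \<le> 12/5 * k + 80" using k by (intro totient_psi_le_linear) simp
  moreover have "1037 \<le> real k" using k by simp
  ultimately have "totient_psi k < ln (real (k * (5 * k choose k)))"
    using ln6 by linarith
  then show ?thesis
    using k n True by (intro not_no_large_power_small[where N = "5 * k"]) auto
next
  case False
  define c where "c = card {p. prime p \<and> p < k}"
  have "ln (20::real) = 2 * ln 2 + ln 5" using ln_mult_pos[of "4::real" 5] by (simp add: ln_4)
  then have "29955/10000 * real k \<le> real k * ln 20"
    using ln_2_bounds ln_5_bounds by (subst mult.commute, intro mult_left_mono) auto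
  moreover have "ln (9::real) = 2 * ln 3" using ln_realpow[of 3 2] by simp
  then have ln9: "ln (9::real) \<le> 3" using ln_3_bounds by simp
  moreover have "real k * ln 20 - ln 9 \<le> ln (real (k * (8 * k choose k)))"
    using ln_mult_binomial_lower[of 8 k 20] k by simp
  moreover have "real c * ln 4 \<le> (real k + 5) / 3 * (13864/10000)"
    using real_card_primes_below[of k] ln_2_bounds unfolding c_def ln_4 by (intro mult_mono) auto
  then have "real c * ln 4 \<le> 4622/10000 * real k + 3" by (simp add: field_simps)
  moreover have "totient_psi k \<le> 12/5 * k + 80" using k by (intro totient_psi_le_linear) simp
  moreover have "1037 \<le> real k" using k by simp
  ultimately have "totient_psi k + real c * ln 4 < ln (real (k * (8 * k choose k)))"
    using ln9 by linarith
  then have "totient_psi k + real c * ln (real 8 / 2) < ln (real (k * (8 * k choose k)))"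
    by simp
  then show ?thesis
    using k False by (intro not_no_large_power_large[where y = 8 and c = c]) (auto simp: c_def)
qed

lemma not_no_large_power_ge_14:
  assumes k: "14 \<le> k" and n: "20 * k \<le> n"
  shows "\<not> no_large_power n k"
proof -
  consider "14 \<le> k \<and> k \<le> 18" | "19 \<le> k \<and> k \<le> 24" | "25 \<le> k \<and> k \<le> 33" | "34 \<le> k \<and> k \<le> 48" | "49 \<le> k \<and> k \<le> 68" | "69 \<le> k \<and> k \<le> 96" | "97 \<le> k \<and> k \<le> 135" | "136 \<le> k"
    using k by linarith
  then show ?thesis
  proof cases
    case 1
    then show ?thesis using n
      by (intro not_no_large_power_checkpoint[OF _ _ _ totient_psi_18, where a = 14]) simp_all
  next
    case 2
    then show ?thesis using n
      by (intro not_no_large_power_checkpoint[OF _ _ _ totient_psi_24, where a = 19]) simp_all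
  next
    case 3
    then show ?thesis using n
      by (intro not_no_large_power_checkpoint[OF _ _ _ totient_psi_33, where a = 25]) simp_all
  next
    case 4
    then show ?thesis using n
      by (intro not_no_large_power_checkpoint[OF _ _ _ totient_psi_48, where a = 34]) simp_all
  next
    case 5
    then show ?thesis using n
      by (intro not_no_large_power_checkpoint[OF _ _ _ totient_psi_68, where a = 49]) simp_all
  next
    case 6
    then show ?thesis using n
      by (intro not_no_large_power_checkpoint[OF _ _ _ totient_psi_96, where a = 69]) simp_all
  next
    case 7
    then show ?thesis using n
      by (intro not_no_large_power_checkpoint[OF _ _ _ totient_psi_135, where a = 97]) simp_all
  qed (use not_no_large_power_20 n in blast)
qed

text \<open>For \<open>n = 4, 9, 10\<close> no prime \<open>P \<le> n\<close> satisfies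
  \<open>4 * n \<le> 5 * P\<close>. With the primes 3, 7, 7 these are the only
  \<open>k \<le> n - P\<close> with \<open>5 * k > n\<close>.\<close>

lemma not_no_large_power_exceptions:
  "\<not> no_large_power 4 1" "\<not> no_large_power 9 2" "\<not> no_large_power 10 3"
proof -
  have *: "\<not> no_large_power n k"
    if "0 < k" "k \<le> n" "n < 8 * k" "totient_psi k \<le> ln (real M)" "0 < M" "M * 1 * fact (k - 1) < (\<Prod>t<k. n - t)"
    for n k M
    using totient_psi_less_ln_binomial[OF that(1,2,4,5) _ that(6)] that
    by (intro not_no_large_power_small[where N = n]) simp_all
  show "\<not> no_large_power 4 1" by (rule *[OF _ _ _ totient_psi_1]) simp_all
  show "\<not> no_large_power 9 2" by (rule *[OF _ _ _ totient_psi_2]) (simp_all add: lessThan_nat_numeral)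
  show "\<not> no_large_power 10 3" by (rule *[OF _ _ _ totient_psi_3]) (simp_all add: lessThan_nat_numeral fact_numeral)
qed

section \<open>Choice of the starting prime and conclusion\<close>

lemma exists_prime_near:
  fixes n :: nat
  assumes "2 \<le> n" "n \<notin> {4, 9, 10}"
  shows "\<exists>P. prime P \<and> P \<le> n \<and> 4 * n \<le> 5 * P \<and> (n - P \<le> 13 \<or> 19 * n \<le> 20 * P \<or> 20736 \<le> n)"
proof -
  consider "n < 11" | "11 \<le> n" "n < 151" | "151 \<le> n" "n < 21283" | "20736 \<le> n" by linarith
  then show ?thesis
  proof cases
    case 1
    then have "n = 2 \<or> n = 3 \<or> n = 5 \<or> n = 6 \<or> n = 7 \<or> n = 8" using assms by auto
    moreover have "prime (2::nat)" "prime (3::nat)" "prime (5::nat)" "prime (7::nat)" by simp_all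
    ultimately show ?thesis
      by (elim disjE) (rule exI[of _ 2] exI[of _ 3] exI[of _ 5] exI[of _ 7], simp; fail)+
  next
    case 2
    then show ?thesis using prime_chain_cover[OF prime_chain_11_151, of n] by auto
  next
    case 3
    then show ?thesis using prime_chain_cover[OF prime_chain_151_20737, of n] by auto
  next
    case 4
    then show ?thesis using exists_prime_four_fifths[of n] by auto
  qed
qed

lemma balanced_const:
  assumes "1 \<le> n" "balanced n a"
  shows "\<exists>c. \<forall>i<n. a i = c"
proof (cases "n = 1")
  case False
  have ex: "\<exists>P. prime P \<and> P \<le> n \<and> n < 2 * P \<and> (\<forall>k. 0 < k \<longrightarrow> k \<le> n - P \<longrightarrow> \<not> no_large_power n k)"
  proof (cases "n \<in> {4, 9, 10}")
    case True
    have le13: "\<not> no_large_power n k" if "0 < k" "k \<le> 13" "5 * k \<le> n" for k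
      using that by (rule not_no_large_power_le_13)
    have pr: "prime (3::nat)" "prime (7::nat)" by simp_all
    from True consider "n = 4" | "n = 9" | "n = 10" by blast
    then show ?thesis
    proof cases
      case 1
      have "\<not> no_large_power n k" if "0 < k" "k \<le> n - 3" for k
      proof -
        have "k = 1" using that 1 by linarith
        then show ?thesis using not_no_large_power_exceptions(1) 1 by simp
      qed
      then show ?thesis using pr(1) 1 by (intro exI[of _ 3]) simp
    next
      case 2
      have "\<not> no_large_power n k" if "0 < k" "k \<le> n - 7" for k
      proof -
        have "k = 1 \<or> k = 2" using that 2 by linarith
        then show ?thesis using not_no_large_power_exceptions(2) le13[of 1] 2 by auto
      qed
      then show ?thesis using pr(2) 2 by (intro exI[of _ 7]) simp
    next
      case 3
      have "\<not> no_large_power n k" if "0 < k" "k \<le> n - 7" for k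
      proof -
        have "k = 1 \<or> k = 2 \<or> k = 3" using that 3 by linarith
        then show ?thesis using not_no_large_power_exceptions(3) le13[of 1] le13[of 2] 3 by auto
      qed
      then show ?thesis using pr(2) 3 by (intro exI[of _ 7]) simp
    qed
  next
    case False
    then obtain P where P: "prime P" "P \<le> n" "4 * n \<le> 5 * P" "n - P \<le> 13 \<or> 19 * n \<le> 20 * P \<or> 20736 \<le> n"
      using exists_prime_near[OF _ False] assms(1) \<open>n \<noteq> 1\<close> by (metis One_nat_def Suc_1 Suc_leI le_neq_implies_less)
    have "\<not> no_large_power n k" if k: "0 < k" "k \<le> n - P" for k
    proof -
      have k5: "5 * k \<le> n" using k P by linarith
      \<comment> \<open>If \<open>n \<ge> 20736\<close> and \<open>20 * k > n\<close>, then
        \<open>k \<ge> 1037\<close>; the other two alternatives for \<open>P\<close> bound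
        \<open>k\<close> directly.\<close>
      consider "k \<le> 13" | "14 \<le> k" "20 * k \<le> n" | "1037 \<le> k"
        using k P by linarith
      then show ?thesis
      proof cases
        case 1
        show ?thesis by (rule not_no_large_power_le_13[OF k(1) 1 k5])
      next
        case 2
        then show ?thesis by (rule not_no_large_power_ge_14)
      next
        case 3
        show ?thesis by (rule not_no_large_power_5[OF 3 k5])
      qed
    qed
    moreover have "n < 2 * P" using P(3) assms(1) by linarith
    ultimately show ?thesis using P by blast
  qed
  then obtain P where P: "prime P" "P \<le> n" "n < 2 * P"
    and no: "\<And>k. 0 < k \<Longrightarrow> k \<le> n - P \<Longrightarrow> \<not> no_large_power n k" by blast
  show ?thesis
  proof (rule balanced_imp_const[OF assms(2) P])
    fix k assume k: "0 < k" "k \<le> n - P"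
    show "\<exists>p t j. prime p \<and> t < k \<and> p ^ Suc j dvd n - t \<and>
       \<not> p dvd (k - 1 choose t) \<and> 2 * k + p ^ j \<le> p ^ Suc j"
      using no[OF k] unfolding no_large_power_def by (meson not_le)
  qed
qed auto

theorem theorem1:
  fixes n :: nat
  assumes "n \<ge> 1"
  shows "absolutely_irreducible Int_Z (binomial_poly n)"
  using assms by (rule absolutely_irreducible_binomial_poly) (rule balanced_const[OF assms])

end
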